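(* Assume that conditions (L1), (R1), (R2) and (R3) listed in the context hold, and that for some $\eta\in\Omega$, $\mu\in\mathcal{M}_1(\Omega)$ and constants $\hat K,\hat\alpha>0$, $$|S(t)f(\eta)-\mu(f)|\le\hat K\,e^{-\hat\alpha t}\,|||f|||\qquad\text{for all } f\in D(\Omega),\ t\ge0.$$ Then there exist $K,\alpha>0$ such that for that particular $\eta$ and all $t\ge0$, $$\bigl|S(t)(fg)(\eta)-[S(t)f(\eta)][S(t)g(\eta)]\bigr|\le K\,|||f|||\;|||g|||\;\varrho(\mathrm{dist}(\Lambda_f,\Lambda_g))^{\alpha}$$ for all $f,g\in D(\Omega)$ with $\mathrm{dist}(\Lambda_f,\Lambda_g)>L\,\mathbf{C}_\varrho$. In particular, $$|\mu(fg)-\mu(f)\mu(g)|\le K\,|||f|||\;|||g|||\;\varrho(\mathrm{dist}(\Lambda_f,\Lambda_g))^{\alpha}$$ for all $f,g\in D(\Omega)$ with $\mathrm{dist}(\Lambda_f,\Lambda_g)>L\,\mathbf{C}_\varrho$.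
   Context: Let $S$ be a countably infinite set with a metric $d$, $q\in\mathbb{N}$, $\Omega=\{0,\dots,q-1\}^S$ with the product topology and Borel $\sigma$-algebra, $\Omega_\Delta=\{0,\dots,q-1\}^\Delta$ for $\Delta\subset S$, $C(\Omega)$ the space of continuous functions $\Omega\to\mathbb{R}$, and $\mathcal{M}_1(\Omega)$ the set of Borel probability measures on $\Omega$. For $\xi_\Delta\in\Omega_\Delta$, $\xi_\Delta\eta_{\Delta^c}$ is the configuration equal to $\xi_\Delta$ on $\Delta$ and to $\eta$ off $\Delta$. The oscillation of $f$ at $x\in S$ is $\delta_x(f)=\sup\{|f(\eta)-f(\xi)|\colon \eta=\xi\text{ off }x\}$; $D(\Omega)=\{f\in C(\Omega)\colon\sum_{x\in S}\delta_x(f)<\infty\}$; $|||f|||=\sum_{x\in S}\delta_x(f)$; $\Lambda_f=\{x\in S\colon\delta_x(f)\neq0\}$; $\mathrm{dist}(\Delta,\Lambda)=\inf\{d(u,v)\colon u\in\Delta,v\in\Lambda\}$. If $\Lambda_f$ or $\Lambda_g$ is empty then $|||f|||\,|||g|||=0$ and the right-hand sides are read as $0$. Rates: for each finite $\Delta\subset S$ and $\xi_\Delta\in\Omega_\Delta$ let $c_\Delta(\cdot,\xi_\Delta)\colon\Omega\to[0,\infty)$ be continuous. The generator is $$\mathscr{L}f(\eta)=\sum_{\Delta\subset S\text{ finite}}\ \sum_{\xi_\Delta\in\Omega_\Delta}c_\Delta(\eta,\xi_\Delta)\,[f(\xi_\Delta\eta_{\Delta^c})-f(\eta)],\quad f\in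 D(\Omega).$$ For $x\ne y$ put $\gamma(x,y)=\sum_{\Delta\ni x}\sum_{\xi_\Delta\in\Omega_\Delta}\delta_y(c_\Delta(\cdot,\xi_\Delta))$, and $\gamma(x,x)=0$. Let $\varrho\colon[0,\infty)\to(0,\infty)$ be non-increasing and $L>0$ a constant. Conditions: (L1) $\mathbf{C}_1:=\sup_{x\in S}\sum_{\Delta\ni x}\sum_{\xi_\Delta}\|c_\Delta(\cdot,\xi_\Delta)\|_\infty<\infty$. (R1) $c_\Delta\equiv0$ whenever $\mathrm{diam}(\Delta)\ge L$. (R2) $\mathbf{C}_\varrho:=\sup_{x,y,z\in S}\frac{\varrho(d(x,z))\varrho(d(z,y))}{\varrho(d(x,y))}<\infty$. (R3) $\mathbf{C}_\gamma:=\sup_{x\in S}\sum_{y\in S}\frac{\gamma(x,y)}{\varrho(d(x,y))}<\infty$. Under (L1) and (R3) (which gives $\sup_x\sum_{y\neq x}\gamma(x,y)<\infty$), $\mathscr{L}$ with core $D(\Omega)$ generates a unique Markov (Feller) semigroup $(S(t))_{t\ge0}$ on $C(\Omega)$. *)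

theory Defs
  imports "HOL-Probability.Probability"
begin

text \<open>
  Sites form a type \<open>'s\<close> with a metric \<open>dist\<close> (its metric topology plays no role), spins a finite
  discrete type \<open>'q\<close>. The type \<open>'s \<Rightarrow> 'q\<close> carries the product topology and is compact, so every
  continuous real function on it is bounded and \<open>C(\<Omega>)\<close> with the supremum norm is the type
  \<open>('s \<Rightarrow> 'q) \<Rightarrow>\<^sub>C real\<close>.
\<close>

type_synonym ('s, 'q) obs = "('s \<Rightarrow> 'q) \<Rightarrow>\<^sub>C real"

text \<open>\<open>c \<Delta> \<xi>\<close> is the function \<open>c\<^sub>\<Delta>(\<cdot>, \<xi>)\<close>; only finite \<open>\<Delta>\<close> and \<open>\<xi> \<in> local_configs \<Delta>\<close> matter.\<close>

type_synonym ('s, 'q) rates = "'s set \<Rightarrow> ('s \<Rightarrow> 'q) \<Rightarrow> ('s, 'q) obs"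

definition local_configs :: "'s set \<Rightarrow> ('s \<Rightarrow> 'q) set" where
  "local_configs \<Delta> = PiE \<Delta> (\<lambda>_. UNIV)"

definition bc_mult ::
    "('a::topological_space \<Rightarrow>\<^sub>C real) \<Rightarrow> ('a \<Rightarrow>\<^sub>C real) \<Rightarrow> ('a \<Rightarrow>\<^sub>C real)" where
  "bc_mult f g = Bcontfun (\<lambda>x. f x * g x)"

lemma apply_bc_mult [simp]: "apply_bcontfun (bc_mult f g) x = f x * g x"
proof -
  have "bounded (range (\<lambda>x. f x * g x))"
  proof (rule boundedI)
    fix y assume "y \<in> range (\<lambda>x. f x * g x)"
    then obtain x where "y = f x * g x" by auto
    then show "norm y \<le> norm f * norm g"
      using mult_mono[OF norm_bounded[of f x] norm_bounded[of g x]]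
      by (simp add: abs_mult)
  qed
  moreover have "continuous_on UNIV (\<lambda>x. f x * g x)"
    using apply_bcontfun[of f] apply_bcontfun[of g]
    by (auto simp: bcontfun_def intro: continuous_on_mult)
  ultimately have "(\<lambda>x. f x * g x) \<in> bcontfun"
    by (simp add: bcontfun_def)
  then show ?thesis
    by (simp add: bc_mult_def Bcontfun_inverse)
qed

definition const_one :: "'a::topological_space \<Rightarrow>\<^sub>C real" where
  "const_one = const_bcontfun 1"

definition osc :: "'s \<Rightarrow> ('s, 'q::topological_space) obs \<Rightarrow> real" where
  "osc x f = (SUP (\<eta>, \<xi>) \<in> {(\<eta>, \<xi>). \<forall>y. y \<noteq> x \<longrightarrow> \<eta> y = \<xi> y}. \<bar>f \<eta> - f \<xi>\<bar>)"

definition D_space :: "('s, 'q::topological_space) obs set" where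
  "D_space = {f. (\<lambda>x. osc x f) summable_on UNIV}"

definition tnorm :: "('s, 'q::topological_space) obs \<Rightarrow> real" where
  "tnorm f = (\<Sum>\<^sub>\<infinity>x. osc x f)"

definition dep_set :: "('s, 'q::topological_space) obs \<Rightarrow> 's set" where
  "dep_set f = {x. osc x f \<noteq> 0}"

text \<open>Unlike \<open>setdist\<close>, this distance is \<open>\<infinity>\<close> if one of the sets is empty.\<close>

definition set_dist :: "'s::metric_space set \<Rightarrow> 's set \<Rightarrow> ennreal" where
  "set_dist A B = (INF u\<in>A. INF v\<in>B. ennreal (dist u v))"

definition rates_nonneg :: "('s, 'q::topological_space) rates \<Rightarrow> bool" where
  "rates_nonneg c \<longleftrightarrow> (\<forall>\<Delta> \<xi> \<eta>. finite \<Delta> \<longrightarrow> \<xi> \<in> local_configs \<Delta> \<longrightarrow> 0 \<le> c \<Delta> \<xi> \<eta>)"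

text \<open>The constants are \<open>ennreal\<close>-valued, so that divergent sums and suprema are \<open>\<infinity>\<close>.\<close>

definition C_one :: "('s, 'q::topological_space) rates \<Rightarrow> ennreal" where
  "C_one c = (SUP x. \<Sum>\<^sub>\<infinity>\<Delta>\<in>{\<Delta>. finite \<Delta> \<and> x \<in> \<Delta>}. \<Sum>\<xi>\<in>local_configs \<Delta>. ennreal (norm (c \<Delta> \<xi>)))"

definition range_less :: "('s::metric_space, 'q::topological_space) rates \<Rightarrow> real \<Rightarrow> bool" where
  "range_less c L \<longleftrightarrow>
     (\<forall>\<Delta>. finite \<Delta> \<longrightarrow> diameter \<Delta> \<ge> L \<longrightarrow> (\<forall>\<xi>\<in>local_configs \<Delta>. c \<Delta> \<xi> = 0))"

definition C_rho :: "'s::metric_space itself \<Rightarrow> (real \<Rightarrow> real) \<Rightarrow> ennreal" where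
  "C_rho _ \<rho> = (SUP (x::'s, y, z). ennreal (\<rho> (dist x z) * \<rho> (dist z y) / \<rho> (dist x y)))"

definition gamma_rate :: "('s, 'q::topological_space) rates \<Rightarrow> 's \<Rightarrow> 's \<Rightarrow> ennreal" where
  "gamma_rate c x y =
     (if x = y then 0
      else \<Sum>\<^sub>\<infinity>\<Delta>\<in>{\<Delta>. finite \<Delta> \<and> x \<in> \<Delta>}. \<Sum>\<xi>\<in>local_configs \<Delta>. ennreal (osc y (c \<Delta> \<xi>)))"

definition C_gamma :: "('s::metric_space, 'q::topological_space) rates \<Rightarrow> (real \<Rightarrow> real) \<Rightarrow> ennreal" where
  "C_gamma c \<rho> = (SUP x. \<Sum>\<^sub>\<infinity>y. gamma_rate c x y / ennreal (\<rho> (dist x y)))"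

definition pregen ::
    "('s, 'q::topological_space) rates \<Rightarrow> ('s, 'q) obs \<Rightarrow> ('s \<Rightarrow> 'q) \<Rightarrow> real" where
  "pregen c f \<eta> =
     (\<Sum>\<^sub>\<infinity>\<Delta>\<in>{\<Delta>. finite \<Delta>}. \<Sum>\<xi>\<in>local_configs \<Delta>. c \<Delta> \<xi> \<eta> * (f (override_on \<eta> \<xi> \<Delta>) - f \<eta>))"

text \<open>
  The graph of the operator on \<open>D(\<Omega>)\<close>. If \<open>C_one c < \<infinity>\<close>, the series converges in supremum norm
  for every \<open>f \<in> D(\<Omega>)\<close>, so that every such \<open>f\<close> occurs.
\<close>

definition pregen_graph ::
    "('s, 'q::topological_space) rates \<Rightarrow> (('s, 'q) obs \<times> ('s, 'q) obs) set" where
  "pregen_graph c = {(f, h). f \<in> D_space \<and> (\<forall>\<eta>. apply_bcontfun h \<eta> = pregen c f \<eta>)}"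

text \<open>Only the values \<open>S t\<close> for \<open>t \<ge> 0\<close> are constrained.\<close>

definition markov_semigroup ::
    "(real \<Rightarrow> ('a::topological_space \<Rightarrow>\<^sub>C real) \<Rightarrow> ('a \<Rightarrow>\<^sub>C real)) \<Rightarrow> bool" where
  "markov_semigroup S \<longleftrightarrow>
     (\<forall>t\<ge>0. linear (S t)) \<and>
     (\<forall>f. S 0 f = f) \<and>
     (\<forall>s\<ge>0. \<forall>t\<ge>0. \<forall>f. S (s + t) f = S s (S t f)) \<and>
     (\<forall>f. ((\<lambda>t. S t f) \<longlongrightarrow> f) (at_right 0)) \<and>
     (\<forall>t\<ge>0. S t const_one = const_one) \<and>
     (\<forall>t\<ge>0. \<forall>f. (\<forall>x. 0 \<le> apply_bcontfun f x) \<longrightarrow> (\<forall>x. 0 \<le> S t f x))"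

definition generator_graph :: "(real \<Rightarrow> 'b \<Rightarrow> 'b) \<Rightarrow> ('b::real_normed_vector \<times> 'b) set" where
  "generator_graph S = {(f, h). ((\<lambda>t. (S t f - f) /\<^sub>R t) \<longlongrightarrow> h) (at_right 0)}"

text \<open>\<open>S\<close> is the semigroup generated by the operator with core \<open>D(\<Omega>)\<close>: its generator is the
  closure of that operator.\<close>

definition generated_by ::
    "(real \<Rightarrow> ('s, 'q::topological_space) obs \<Rightarrow> ('s, 'q) obs) \<Rightarrow> ('s, 'q) rates \<Rightarrow> bool" where
  "generated_by S c \<longleftrightarrow> markov_semigroup S \<and> generator_graph S = closure (pregen_graph c)"

end

theory Submission
  imports Defs "HOL-Real_Asymp.Real_Asymp"
begin

text \<open>
  Truncating the generator to finitely many sets \<open>\<Delta>\<close> and discretising time gives Euler operators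
  \<open>P = 1 + h L\<close> that are positive contractions for small \<open>h\<close> and satisfy
  \<open>osc (P f) \<le> osc f + h \<Gamma>\<^sup>T osc f\<close>, where \<open>\<Gamma>\<close> is the influence matrix. By R2 and R3, \<open>\<Gamma>\<close> has finite norm
  with respect to the weights \<open>1 / \<rho> (dist \<Lambda> x)\<close>. A resolvent of \<open>\<Gamma>\<close> applied to \<open>osc f\<close> thus dominates
  all iterates up to a factor \<open>exp (t / \<theta>)\<close>, is summable, and is still \<open>\<rho>\<close>-localised near the
  dependence set of \<open>f\<close>. Summability lets the truncated iterates converge to \<open>S t f\<close> (a Duhamel
  argument on linear pieces). Localisation bounds the defect \<open>P (f g) - P f P g\<close>, which to first order in
  \<open>h\<close> is \<open>h\<close> times a carre du champ coupling only sites at distance less than \<open>L\<close>: telescoping gives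
  \<open>|S t (f g) - S t f S t g| \<le> C exp (B t) \<rho> (dist \<Lambda>\<^sub>f \<Lambda>\<^sub>g)\<close>. The assumed exponential decay freezes the
  covariance after a time of order \<open>ln (1 / \<rho>)\<close>, which turns the growing factor into a loss in the exponent of
  \<open>\<rho>\<close>. Subtracting \<open>f \<eta>\<close> and \<open>g \<eta>\<close> first, one may replace sup norms by \<open>tnorm\<close>.
\<close>

subsection \<open>Oscillations\<close>

lemma osc_bdd:
  fixes f :: "('s, 'q::topological_space) obs"
  shows "bdd_above ((\<lambda>(\<eta>, \<xi>). \<bar>apply_bcontfun f \<eta> - f \<xi>\<bar>) ` A)"
proof (rule bdd_aboveI2)
  fix p assume "p \<in> A"
  show "(case p of (\<eta>, \<xi>) \<Rightarrow> \<bar>apply_bcontfun f \<eta> - f \<xi>\<bar>) \<le> 2 * norm f"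
    using norm_bounded[of f "fst p"] norm_bounded[of f "snd p"]
    by (auto simp: case_prod_beta)
qed

lemma osc_upper: "(\<And>y. y \<noteq> x \<Longrightarrow> \<eta> y = \<xi> y) \<Longrightarrow> \<bar>apply_bcontfun f \<eta> - f \<xi>\<bar> \<le> osc x f"
  unfolding osc_def by (rule cSUP_upper2[OF osc_bdd, where x = "(\<eta>, \<xi>)"]) auto

lemma osc_least:
  assumes "\<And>\<eta> \<xi>. (\<And>y. y \<noteq> x \<Longrightarrow> \<eta> y = \<xi> y) \<Longrightarrow> \<bar>apply_bcontfun f \<eta> - f \<xi>\<bar> \<le> B"
  shows "osc x f \<le> B"
  unfolding osc_def
proof (rule cSUP_least)
  have "(\<lambda>_. undefined, \<lambda>_. undefined) \<in> {(\<eta>, \<xi>). \<forall>y. y \<noteq> x \<longrightarrow> \<eta> y = \<xi> y}" by simp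
  then show "{(\<eta>, \<xi>). \<forall>y. y \<noteq> x \<longrightarrow> \<eta> y = \<xi> y} \<noteq> {}" by (metis (no_types) empty_iff)
qed (use assms in auto)

lemma osc_nonneg [simp]: "0 \<le> osc x f"
  using osc_upper[of x "\<lambda>_. undefined" "\<lambda>_. undefined" f] by simp

lemma osc_le_norm: "osc x f \<le> 2 * norm f"
proof (rule osc_least)
  fix \<eta> \<xi>
  show "\<bar>apply_bcontfun f \<eta> - f \<xi>\<bar> \<le> 2 * norm f"
    using norm_bounded[of f \<eta>] norm_bounded[of f \<xi>] by auto
qed

lemma osc_add: "osc x (f + g) \<le> osc x f + osc x g"
proof (rule osc_least)
  fix \<eta> \<xi> :: "'a \<Rightarrow> 'b" assume *: "\<And>y. y \<noteq> x \<Longrightarrow> \<eta> y = \<xi> y"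
  show "\<bar>apply_bcontfun (f + g) \<eta> - (f + g) \<xi>\<bar> \<le> osc x f + osc x g"
    using osc_upper[of x \<eta> \<xi> f, OF *] osc_upper[of x \<eta> \<xi> g, OF *] by (auto simp: plus_bcontfun.rep_eq)
qed

lemma osc_scaleR: "osc x (r *\<^sub>R f) \<le> \<bar>r\<bar> * osc x f"
proof (rule osc_least)
  fix \<eta> \<xi> :: "'a \<Rightarrow> 'b" assume *: "\<And>y. y \<noteq> x \<Longrightarrow> \<eta> y = \<xi> y"
  show "\<bar>apply_bcontfun (r *\<^sub>R f) \<eta> - (r *\<^sub>R f) \<xi>\<bar> \<le> \<bar>r\<bar> * osc x f"
    using mult_left_mono[OF osc_upper[of x \<eta> \<xi> f, OF *], of "\<bar>r\<bar>"]
    by (simp add: scaleR_bcontfun.rep_eq abs_mult flip: right_diff_distrib)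
qed

lemma osc_bc_mult: "osc x (bc_mult f g) \<le> norm f * osc x g + norm g * osc x f"
proof (rule osc_least)
  fix \<eta> \<xi> :: "'a \<Rightarrow> 'b" assume *: "\<And>y. y \<noteq> x \<Longrightarrow> \<eta> y = \<xi> y"
  have "f \<eta> * g \<eta> - f \<xi> * g \<xi> = f \<eta> * (g \<eta> - g \<xi>) + g \<xi> * (f \<eta> - f \<xi>)"
    by (simp add: algebra_simps)
  also have "\<bar>\<dots>\<bar> \<le> \<bar>f \<eta>\<bar> * \<bar>g \<eta> - g \<xi>\<bar> + \<bar>g \<xi>\<bar> * \<bar>f \<eta> - f \<xi>\<bar>"
    by (metis abs_mult abs_triangle_ineq)
  also have "\<dots> \<le> norm f * osc x g + norm g * osc x f"
    using norm_bounded[of f \<eta>] norm_bounded[of g \<xi>]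
      osc_upper[of x \<eta> \<xi> f, OF *] osc_upper[of x \<eta> \<xi> g, OF *]
    by (intro add_mono mult_mono) auto
  finally show "\<bar>apply_bcontfun (bc_mult f g) \<eta> - bc_mult f g \<xi>\<bar> \<le> norm f * osc x g + norm g * osc x f"
    by simp
qed

lemma osc_diff_const [simp]: "osc x (f - const_bcontfun a) = osc x f"
  by (simp add: osc_def minus_bcontfun.rep_eq const_bcontfun.rep_eq)

text \<open>Change the sites of \<Delta> one at a time; each single-site change costs at most the
  oscillation at that site.\<close>

lemma osc_finite_change:
  assumes "finite \<Delta>" "\<And>y. y \<notin> \<Delta> \<Longrightarrow> \<eta> y = \<xi> y"
  shows "\<bar>apply_bcontfun f \<eta> - f \<xi>\<bar> \<le> (\<Sum>x\<in>\<Delta>. osc x f)"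
  using assms
proof (induction \<Delta> arbitrary: \<xi> rule: finite_induct)
  case empty
  then have "\<eta> = \<xi>" by auto
  then show ?case by simp
next
  case (insert x \<Delta>)
  have "\<bar>apply_bcontfun f \<eta> - f (\<xi>(x := \<eta> x))\<bar> \<le> (\<Sum>x\<in>\<Delta>. osc x f)"
    by (rule insert.IH) (use insert.prems in auto)
  moreover have "\<bar>apply_bcontfun f (\<xi>(x := \<eta> x)) - f \<xi>\<bar> \<le> osc x f"
    by (rule osc_upper) auto
  ultimately show ?case using insert.hyps by simp
qed

section \<open>Functions with summable oscillations\<close>

lemma D_spaceD: "f \<in> D_space \<Longrightarrow> (\<lambda>x. osc x f) summable_on UNIV"
  by (simp add: D_space_def)

lemma D_spaceI:
  assumes "b summable_on UNIV" "\<And>x. osc x f \<le> b x"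
  shows "f \<in> D_space"
  unfolding D_space_def mem_Collect_eq
  by (rule summable_on_comparison_test[OF assms(1)]) (use assms(2) in auto)

lemma tnorm_nonneg [simp]: "0 \<le> tnorm f"
  unfolding tnorm_def by (rule infsum_nonneg) auto

lemma D_space_add: "f \<in> D_space \<Longrightarrow> g \<in> D_space \<Longrightarrow> f + g \<in> D_space"
  by (rule D_spaceI[OF summable_on_add[OF D_spaceD D_spaceD] osc_add])

lemma D_space_scaleR: "f \<in> D_space \<Longrightarrow> r *\<^sub>R f \<in> D_space"
  by (rule D_spaceI[OF summable_on_cmult_right[OF D_spaceD] osc_scaleR])

lemma D_space_bc_mult: "f \<in> D_space \<Longrightarrow> g \<in> D_space \<Longrightarrow> bc_mult f g \<in> D_space"
  by (rule D_spaceI[OF summable_on_add[OF summable_on_cmult_right[OF D_spaceD] summable_on_cmult_right[OF D_spaceD]] osc_bc_mult])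

lemma tnorm_bc_mult:
  assumes "f \<in> D_space" "g \<in> D_space"
  shows "tnorm (bc_mult f g) \<le> norm f * tnorm g + norm g * tnorm f"
proof -
  have "tnorm (bc_mult f g) \<le> (\<Sum>\<^sub>\<infinity>x. norm f * osc x g + norm g * osc x f)"
    unfolding tnorm_def using assms
    by (intro infsum_mono osc_bc_mult summable_on_add summable_on_cmult_right D_spaceD D_space_bc_mult)
  also have "\<dots> = norm f * tnorm g + norm g * tnorm f"
    unfolding tnorm_def using assms
    by (subst infsum_add) (auto simp: infsum_cmult_right' intro!: summable_on_cmult_right D_spaceD)
  finally show ?thesis .
qed

lemma D_space_diff_const [simp]: "f - const_bcontfun a \<in> D_space \<longleftrightarrow> f \<in> D_space"
  by (simp add: D_space_def)

lemma tnorm_diff_const [simp]: "tnorm (f - const_bcontfun a) = tnorm f"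
  by (simp add: tnorm_def)

lemma dep_set_diff_const [simp]: "dep_set (f - const_bcontfun a) = dep_set f"
  by (simp add: dep_set_def)

text \<open>Each coordinate x is eventually constant, namely as soon as x lies in \<Delta>, and
  convergence in the product topology is coordinatewise.\<close>

lemma tendsto_override_on:
  "((\<lambda>\<Delta>. override_on \<xi> \<eta> \<Delta>) \<longlongrightarrow> \<eta>) (finite_subsets_at_top (UNIV :: 'a set))"
  for \<eta> \<xi> :: "'a \<Rightarrow> 'b::topological_space"
proof -
  have "eventually (\<lambda>\<Delta>. override_on \<xi> \<eta> \<Delta> x = \<eta> x) (finite_subsets_at_top (UNIV :: 'a set))" for x
    unfolding eventually_finite_subsets_at_top by (rule exI[of _ "{x}"]) auto
  then have "((\<lambda>\<Delta>. override_on \<xi> \<eta> \<Delta> x) \<longlongrightarrow> \<eta> x) (finite_subsets_at_top (UNIV :: 'a set))" for x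
    by (rule tendsto_eventually)
  then have "limitin (product_topology (\<lambda>i. euclidean) UNIV) (\<lambda>\<Delta>. override_on \<xi> \<eta> \<Delta>) \<eta>
      (finite_subsets_at_top (UNIV :: 'a set))"
    by (simp add: limitin_componentwise)
  then show ?thesis by (simp add: euclidean_product_topology)
qed

text \<open>The bound for finitely many changed sites passes to arbitrary pairs by continuity of f.
  It lets \<open>tnorm\<close> control the supremum norm of f once a value of f has been
  subtracted.\<close>

lemma diff_le_tnorm:
  assumes "f \<in> D_space"
  shows "\<bar>apply_bcontfun f \<eta> - f \<xi>\<bar> \<le> tnorm f"
proof -
  have "((\<lambda>\<Delta>. \<bar>f (override_on \<xi> \<eta> \<Delta>) - f \<xi>\<bar>) \<longlongrightarrow> \<bar>f \<eta> - f \<xi>\<bar>) (finite_subsets_at_top UNIV)"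
    by (intro tendsto_intros continuous_on_tendsto_compose[OF continuous_on_apply_bcontfun[of UNIV f]]
        tendsto_override_on) auto
  moreover have "eventually (\<lambda>\<Delta>. \<bar>f (override_on \<xi> \<eta> \<Delta>) - f \<xi>\<bar> \<le> tnorm f) (finite_subsets_at_top UNIV)"
  proof (rule eventually_finite_subsets_at_top_weakI)
    fix \<Delta> :: "'a set" assume \<Delta>: "finite \<Delta>"
    have "\<bar>f (override_on \<xi> \<eta> \<Delta>) - f \<xi>\<bar> \<le> (\<Sum>x\<in>\<Delta>. osc x f)"
      by (rule osc_finite_change[OF \<Delta>]) auto
    also have "\<dots> \<le> tnorm f" unfolding tnorm_def
      by (rule finite_sum_le_infsum) (use assms \<Delta> in \<open>auto intro: D_spaceD\<close>)
    finally show "\<bar>f (override_on \<xi> \<eta> \<Delta>) - f \<xi>\<bar> \<le> tnorm f" .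
  qed
  ultimately show ?thesis by (rule tendsto_upperbound) simp
qed

subsection \<open>Truncated and full generators\<close>

lemma apply_bcontfun_sum: "apply_bcontfun (sum f A) x = (\<Sum>i\<in>A. apply_bcontfun (f i) x)"
  for f :: "'i \<Rightarrow> 'a::topological_space \<Rightarrow>\<^sub>C 'b::real_normed_vector"
  by (induction A rule: infinite_finite_induct) auto

lemma norm_bc_mult: "norm (bc_mult f g) \<le> norm f * norm g"
proof (rule norm_bound)
  show "norm (apply_bcontfun (bc_mult f g) x) \<le> norm f * norm g" for x
    using mult_mono[OF norm_bounded[of f x] norm_bounded[of g x]] by (simp add: abs_mult)
qed

definition glue :: "('s \<Rightarrow> 'q) \<Rightarrow> 's set \<Rightarrow> ('s, 'q::topological_space) obs \<Rightarrow> ('s, 'q) obs" where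
  "glue \<xi> \<Delta> f = Bcontfun (\<lambda>\<eta>. f (override_on \<eta> \<xi> \<Delta>))"

definition rate_bound :: "('s, 'q::topological_space) rates \<Rightarrow> 's set \<Rightarrow> real" where
  "rate_bound c \<Delta> = (\<Sum>\<xi>\<in>local_configs \<Delta>. norm (c \<Delta> \<xi>))"

definition jump :: "('s, 'q::topological_space) rates \<Rightarrow> 's set \<Rightarrow> ('s, 'q) obs \<Rightarrow> ('s, 'q) obs" where
  "jump c \<Delta> f = (\<Sum>\<xi>\<in>local_configs \<Delta>. bc_mult (c \<Delta> \<xi>) (glue \<xi> \<Delta> f - f))"

text \<open>The generator truncated to A. For finite A it is a bounded operator, so it can be
  iterated on all of C(\<Omega>).\<close>

definition gen :: "('s, 'q::topological_space) rates \<Rightarrow> 's set set \<Rightarrow> ('s, 'q) obs \<Rightarrow> ('s, 'q) obs" where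
  "gen c A f = (\<Sum>\<Delta>\<in>A. jump c \<Delta> f)"

text \<open>Defined pointwise rather than as a norm-convergent sum: \<open>bcontfun\<close> is an instance of \<open>banach\<close> only
  over a metric domain.\<close>

definition full_gen :: "('s, 'q::topological_space) rates \<Rightarrow> ('s, 'q) obs \<Rightarrow> ('s, 'q) obs" where
  "full_gen c f = Bcontfun (pregen c f)"

lemma continuous_override_on:
  "continuous_on UNIV (\<lambda>\<eta> :: 's \<Rightarrow> 'q::topological_space. override_on \<eta> \<xi> \<Delta>)"
proof (rule continuous_on_coordinatewise_then_product)
  fix x :: 's
  show "continuous_on UNIV (\<lambda>\<eta> :: 's \<Rightarrow> 'q. override_on \<eta> \<xi> \<Delta> x)"
    by (cases "x \<in> \<Delta>") (auto intro: continuous_on_product_coordinates)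
qed

lemma apply_glue [simp]: "apply_bcontfun (glue \<xi> \<Delta> f) \<eta> = f (override_on \<eta> \<xi> \<Delta>)"
proof -
  have "continuous_on UNIV (\<lambda>\<eta>. f (override_on \<eta> \<xi> \<Delta>))"
    by (rule continuous_on_compose2[OF continuous_on_apply_bcontfun[of UNIV f] continuous_override_on]) auto
  then have "(\<lambda>\<eta>. f (override_on \<eta> \<xi> \<Delta>)) \<in> bcontfun"
    by (rule bcontfun_normI[where b = "norm f"]) (rule norm_bounded)
  then show ?thesis by (simp add: glue_def Bcontfun_inverse)
qed

lemma rate_bound_nonneg [simp]: "0 \<le> rate_bound c \<Delta>"
  unfolding rate_bound_def by (rule sum_nonneg) auto

lemma apply_jump:
  "apply_bcontfun (jump c \<Delta> f) \<eta> =
    (\<Sum>\<xi>\<in>local_configs \<Delta>. c \<Delta> \<xi> \<eta> * (f (override_on \<eta> \<xi> \<Delta>) - f \<eta>))"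
  by (simp add: jump_def apply_bcontfun_sum)

text \<open>The bound on the increments is left open: oscillations give an estimate that can be
  summed over all finite \<Delta>, the supremum norm one that makes each truncated generator
  bounded.\<close>

lemma norm_jump_le:
  fixes f :: "('s, 'q::topological_space) obs"
  assumes "\<And>\<eta> \<xi>. \<bar>f (override_on \<eta> \<xi> \<Delta>) - f \<eta>\<bar> \<le> B"
  shows "norm (jump c \<Delta> f) \<le> rate_bound c \<Delta> * B"
proof (rule norm_bound)
  fix \<eta>
  have "norm (apply_bcontfun (jump c \<Delta> f) \<eta>)
      \<le> (\<Sum>\<xi>\<in>local_configs \<Delta>. \<bar>c \<Delta> \<xi> \<eta>\<bar> * \<bar>f (override_on \<eta> \<xi> \<Delta>) - f \<eta>\<bar>)"
    unfolding apply_jump by (rule order_trans[OF norm_sum]) (simp add: abs_mult)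
  also have "\<dots> \<le> (\<Sum>\<xi>\<in>local_configs \<Delta>. norm (c \<Delta> \<xi>) * B)"
    using assms norm_bounded[of "c \<Delta> _" \<eta>] by (intro sum_mono mult_mono) auto
  finally show "norm (apply_bcontfun (jump c \<Delta> f) \<eta>) \<le> rate_bound c \<Delta> * B"
    by (simp add: rate_bound_def sum_distrib_right)
qed

lemma norm_jump_osc: "finite \<Delta> \<Longrightarrow> norm (jump c \<Delta> f) \<le> rate_bound c \<Delta> * (\<Sum>x\<in>\<Delta>. osc x f)"
  by (intro norm_jump_le osc_finite_change) auto

lemma norm_jump_norm: "norm (jump c \<Delta> f) \<le> rate_bound c \<Delta> * (2 * norm f)"
proof (rule norm_jump_le)
  fix \<eta> \<xi>
  show "\<bar>f (override_on \<eta> \<xi> \<Delta>) - f \<eta>\<bar> \<le> 2 * norm f"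
    using norm_bounded[of f \<eta>] norm_bounded[of f "override_on \<eta> \<xi> \<Delta>"] by auto
qed

lemma norm_gen_norm: "norm (gen c A f) \<le> 2 * (\<Sum>\<Delta>\<in>A. rate_bound c \<Delta>) * norm f"
proof -
  have "norm (gen c A f) \<le> (\<Sum>\<Delta>\<in>A. rate_bound c \<Delta> * (2 * norm f))"
    unfolding gen_def by (rule order_trans[OF norm_sum]) (intro sum_mono norm_jump_norm)
  then show ?thesis by (simp add: sum_distrib_left mult_ac)
qed

lemma jump_add: "jump c \<Delta> (f + g) = jump c \<Delta> f + jump c \<Delta> g"
  by (rule bcontfun_eqI) (simp add: apply_jump algebra_simps flip: sum.distrib)

lemma jump_scaleR: "jump c \<Delta> (r *\<^sub>R f) = r *\<^sub>R jump c \<Delta> f"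
  by (rule bcontfun_eqI) (simp add: apply_jump algebra_simps sum_distrib_left)

lemma gen_add: "gen c A (f + g) = gen c A f + gen c A g"
  by (simp add: gen_def jump_add sum.distrib)

lemma gen_scaleR: "gen c A (r *\<^sub>R f) = r *\<^sub>R gen c A f"
  by (simp add: gen_def jump_scaleR scaleR_sum_right)

section \<open>Summing rates over sites and sets\<close>

lemma finite_local_configs [simp]:
  "finite \<Delta> \<Longrightarrow> finite (local_configs \<Delta> :: ('s \<Rightarrow> 'q::finite) set)"
  unfolding local_configs_def by (intro finite_PiE) auto

lemma finite_sum_le_infsum_ennreal:
  fixes f :: "'a \<Rightarrow> ennreal"
  shows "finite F \<Longrightarrow> F \<subseteq> A \<Longrightarrow> sum f F \<le> infsum f A"
  by (simp add: nonneg_infsum_complete SUP_upper)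

lemma rate_bound_sum_le:
  assumes L1: "C_one c < \<infinity>" and A: "finite A" "\<And>\<Delta>. \<Delta> \<in> A \<Longrightarrow> finite \<Delta> \<and> x \<in> \<Delta>"
  shows "(\<Sum>\<Delta>\<in>A. rate_bound c \<Delta>) \<le> enn2real (C_one c)"
proof -
  have "ennreal (\<Sum>\<Delta>\<in>A. rate_bound c \<Delta>)
      = (\<Sum>\<Delta>\<in>A. \<Sum>\<xi>\<in>local_configs \<Delta>. ennreal (norm (c \<Delta> \<xi>)))"
    by (simp add: rate_bound_def sum_nonneg)
  also have "\<dots> \<le> (\<Sum>\<^sub>\<infinity>\<Delta>\<in>{\<Delta>. finite \<Delta> \<and> x \<in> \<Delta>}. \<Sum>\<xi>\<in>local_configs \<Delta>. ennreal (norm (c \<Delta> \<xi>)))"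
    by (rule finite_sum_le_infsum_ennreal) (use A in auto)
  also have "\<dots> \<le> C_one c"
    unfolding C_one_def by (rule SUP_upper) simp
  finally show ?thesis using L1 
    by (metis enn2real_ennreal enn2real_mono infinity_ennreal_def rate_bound_nonneg sum_nonneg)
qed

text \<open>After exchanging the sums, each site x carries the total rate of the sets containing it,
  which is at most \<open>C_one c\<close> by (L1).\<close>

lemma sum_rate_bound_sites_le:
  fixes b :: "'s \<Rightarrow> real"
  assumes L1: "C_one c < \<infinity>" and A: "finite A" "\<And>\<Delta>. \<Delta> \<in> A \<Longrightarrow> finite \<Delta>"
    and b: "\<And>x. 0 \<le> b x" "b summable_on UNIV"
  shows "(\<Sum>\<Delta>\<in>A. rate_bound c \<Delta> * (\<Sum>x\<in>\<Delta>. b x)) \<le> enn2real (C_one c) * infsum b UNIV"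
proof -
  have fin: "finite (\<Union>A)" using A by auto
  have "(\<Sum>\<Delta>\<in>A. rate_bound c \<Delta> * (\<Sum>x\<in>\<Delta>. b x))
      = (\<Sum>\<Delta>\<in>A. \<Sum>x | x \<in> \<Union>A \<and> x \<in> \<Delta>. rate_bound c \<Delta> * b x)"
    by (intro sum.cong refl) (auto simp: sum_distrib_left intro!: sum.cong)
  also have "\<dots> = (\<Sum>x\<in>\<Union>A. \<Sum>\<Delta> | \<Delta> \<in> A \<and> x \<in> \<Delta>. rate_bound c \<Delta> * b x)"
    by (rule sum.swap_restrict[OF A(1) fin])
  also have "\<dots> = (\<Sum>x\<in>\<Union>A. (\<Sum>\<Delta> | \<Delta> \<in> A \<and> x \<in> \<Delta>. rate_bound c \<Delta>) * b x)"
    by (simp add: sum_distrib_right)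
  also have "\<dots> \<le> (\<Sum>x\<in>\<Union>A. enn2real (C_one c) * b x)"
    using A b by (intro sum_mono mult_right_mono rate_bound_sum_le[OF L1]) auto
  also have "\<dots> = enn2real (C_one c) * sum b (\<Union>A)" by (simp add: sum_distrib_left)
  also have "\<dots> \<le> enn2real (C_one c) * infsum b UNIV"
    using b fin by (intro mult_left_mono finite_sum_le_infsum) auto
  finally show ?thesis .
qed

lemma summable_rate_bound_sites:
  fixes b :: "'s \<Rightarrow> real"
  assumes L1: "C_one c < \<infinity>" and b: "\<And>x. 0 \<le> b x" "b summable_on UNIV"
  shows "(\<lambda>\<Delta>. rate_bound c \<Delta> * (\<Sum>x\<in>\<Delta>. b x)) summable_on {\<Delta>. finite \<Delta>}"
proof (rule nonneg_bdd_above_summable_on)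
  show "0 \<le> rate_bound c \<Delta> * (\<Sum>x\<in>\<Delta>. b x)" for \<Delta> using b by (simp add: sum_nonneg)
  show "bdd_above (sum (\<lambda>\<Delta>. rate_bound c \<Delta> * (\<Sum>x\<in>\<Delta>. b x)) ` {F. F \<subseteq> {\<Delta>. finite \<Delta>} \<and> finite F})"
    by (rule bdd_aboveI2[where M = "enn2real (C_one c) * infsum b UNIV"])
      (use sum_rate_bound_sites_le[OF L1 _ _ b] in auto)
qed

lemma tail_tendsto_0:
  fixes g :: "'a \<Rightarrow> real"
  assumes "g summable_on X"
  shows "((\<lambda>A. infsum g (X - A)) \<longlongrightarrow> 0) (finite_subsets_at_top X)"
proof -
  have "((\<lambda>A. infsum g X - sum g A) \<longlongrightarrow> infsum g X - infsum g X) (finite_subsets_at_top X)"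
    by (intro tendsto_intros infsum_tendsto assms)
  moreover have "eventually (\<lambda>A. infsum g X - sum g A = infsum g (X - A)) (finite_subsets_at_top X)"
    by (rule eventually_finite_subsets_at_top_weakI) (use assms in \<open>simp add: infsum_Diff\<close>)
  ultimately show ?thesis using tendsto_cong by fastforce
qed

text \<open>The error is measured by an arbitrary summable majorant b of the oscillations, so that a
  single tail serves all Euler iterates of a function at once.\<close>

lemma pregen_diff_le:
  assumes L1: "C_one c < \<infinity>" and A: "finite A" "A \<subseteq> {\<Delta>. finite \<Delta>}"
    and b: "\<And>x. osc x f \<le> b x" "b summable_on UNIV"
  shows "\<bar>pregen c f \<eta> - gen c A f \<eta>\<bar>
    \<le> (\<Sum>\<^sub>\<infinity>\<Delta>\<in>{\<Delta>. finite \<Delta>} - A. rate_bound c \<Delta> * (\<Sum>x\<in>\<Delta>. b x))"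
proof -
  have b0: "0 \<le> b x" for x using order_trans[OF osc_nonneg b(1)] .
  note s = summable_rate_bound_sites[OF L1 b0 b(2)]
  have le: "\<bar>jump c \<Delta> f \<eta>\<bar> \<le> rate_bound c \<Delta> * (\<Sum>x\<in>\<Delta>. b x)" if "finite \<Delta>" for \<Delta>
  proof -
    have "\<bar>jump c \<Delta> f \<eta>\<bar> \<le> rate_bound c \<Delta> * (\<Sum>x\<in>\<Delta>. osc x f)"
      using norm_bounded[of "jump c \<Delta> f" \<eta>] norm_jump_osc[OF that, of c f] by simp
    also have "\<dots> \<le> rate_bound c \<Delta> * (\<Sum>x\<in>\<Delta>. b x)"
      by (intro mult_left_mono sum_mono b) simp
    finally show ?thesis .
  qed
  have j: "(\<lambda>\<Delta>. jump c \<Delta> f \<eta>) summable_on {\<Delta>. finite \<Delta>}"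
    by (rule abs_summable_summable, rule summable_on_comparison_test[OF s]) (use le in auto)
  have "pregen c f \<eta> - gen c A f \<eta> = infsum (\<lambda>\<Delta>. jump c \<Delta> f \<eta>) ({\<Delta>. finite \<Delta>} - A)"
    unfolding pregen_def gen_def apply_bcontfun_sum using A j
    by (subst infsum_Diff) (auto simp: apply_jump)
  also have "norm \<dots> \<le> (\<Sum>\<^sub>\<infinity>\<Delta>\<in>{\<Delta>. finite \<Delta>} - A. rate_bound c \<Delta> * (\<Sum>x\<in>\<Delta>. b x))"
    using A j s le by (intro norm_infsum_le[OF has_sum_infsum has_sum_infsum] summable_on_Diff) auto
  finally show ?thesis by simp
qed

text \<open>The tail bound does not depend on \<eta>, so \<open>pregen c f\<close> is a uniform
  limit of the continuous functions \<open>gen c A f\<close>.\<close>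

lemma apply_full_gen:
  assumes L1: "C_one c < \<infinity>" and f: "f \<in> D_space"
  shows "apply_bcontfun (full_gen c f) \<eta> = pregen c f \<eta>"
proof -
  let ?r = "\<lambda>A. \<Sum>\<^sub>\<infinity>\<Delta>\<in>{\<Delta>. finite \<Delta>} - A. rate_bound c \<Delta> * (\<Sum>x\<in>\<Delta>. osc x f)"
  have le: "\<bar>pregen c f \<eta> - gen c A f \<eta>\<bar> \<le> ?r A" if "finite A" "A \<subseteq> {\<Delta>. finite \<Delta>}" for A \<eta>
    using pregen_diff_le[OF L1 that order_refl D_spaceD[OF f]] .
  have "uniform_limit UNIV (\<lambda>A. apply_bcontfun (gen c A f)) (pregen c f)
      (finite_subsets_at_top {\<Delta>. finite \<Delta>})"
  proof (rule uniform_limitI)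
    fix e :: real assume "e > 0"
    have "eventually (\<lambda>A. ?r A < e) (finite_subsets_at_top {\<Delta>. finite \<Delta>})"
      using order_tendstoD(2)[OF tail_tendsto_0[OF summable_rate_bound_sites[OF L1 osc_nonneg D_spaceD[OF f]]] \<open>e > 0\<close>] .
    moreover have "eventually (\<lambda>A. \<forall>\<eta>\<in>UNIV. dist (gen c A f \<eta>) (pregen c f \<eta>) \<le> ?r A)
        (finite_subsets_at_top {\<Delta>. finite \<Delta>})"
      by (rule eventually_finite_subsets_at_top_weakI) (use le in \<open>auto simp: dist_real_def abs_minus_commute\<close>)
    ultimately show "eventually (\<lambda>A. \<forall>\<eta>\<in>UNIV. dist (gen c A f \<eta>) (pregen c f \<eta>) < e)
        (finite_subsets_at_top {\<Delta>. finite \<Delta>})"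
      by eventually_elim (auto intro: le_less_trans)
  qed
  then have "continuous_on UNIV (pregen c f)"
    by (rule uniform_limit_theorem[rotated]) auto
  \<comment> \<open>The empty truncation is the zero operator, so its tail bounds
    \<open>pregen c f\<close> itself.\<close>
  moreover have "norm (pregen c f \<eta>) \<le> ?r {}" for \<eta>
    using le[of "{}" \<eta>] by (simp add: gen_def)
  ultimately have "pregen c f \<in> bcontfun" by (rule bcontfun_normI)
  then show ?thesis by (simp add: full_gen_def Bcontfun_inverse)
qed

lemma full_gen_in_pregen_graph:
  "C_one c < \<infinity> \<Longrightarrow> f \<in> D_space \<Longrightarrow> (f, full_gen c f) \<in> pregen_graph c"
  by (simp add: pregen_graph_def apply_full_gen)

lemma norm_full_gen_diff_le:
  assumes L1: "C_one c < \<infinity>" and f: "f \<in> D_space" and A: "finite A" "A \<subseteq> {\<Delta>. finite \<Delta>}"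
    and b: "\<And>x. osc x f \<le> b x" "b summable_on UNIV"
  shows "norm (full_gen c f - gen c A f)
    \<le> (\<Sum>\<^sub>\<infinity>\<Delta>\<in>{\<Delta>. finite \<Delta>} - A. rate_bound c \<Delta> * (\<Sum>x\<in>\<Delta>. b x))"
  by (rule norm_bound) (use pregen_diff_le[OF L1 A b] in \<open>simp add: apply_full_gen[OF L1 f]\<close>)

subsection \<open>Euler steps for Markov semigroups\<close>

lemma markov_linear: "markov_semigroup S \<Longrightarrow> 0 \<le> t \<Longrightarrow> linear (S t)"
  by (simp add: markov_semigroup_def)

lemma markov_semigroup_add:
  "markov_semigroup S \<Longrightarrow> 0 \<le> s \<Longrightarrow> 0 \<le> t \<Longrightarrow> S (s + t) f = S s (S t f)"
  by (simp add: markov_semigroup_def)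

lemma markov_const:
  assumes "markov_semigroup S" "0 \<le> t"
  shows "S t (const_bcontfun a) = const_bcontfun a"
proof -
  have "const_bcontfun a = a *\<^sub>R (const_one :: 'a \<Rightarrow>\<^sub>C real)"
    by (rule bcontfun_eqI) (simp add: const_one_def const_bcontfun.rep_eq)
  then show ?thesis
    using assms linear_scale[OF markov_linear[OF assms]] by (simp add: markov_semigroup_def)
qed

text \<open>Positivity is applied to the constant \<open>norm f\<close> minus f and plus f;
  constants are fixed by the semigroup.\<close>

lemma markov_contraction:
  fixes f :: "'a::topological_space \<Rightarrow>\<^sub>C real"
  assumes S: "markov_semigroup S" and t: "0 \<le> t"
  shows "norm (S t f) \<le> norm f"
proof (rule norm_bound)
  fix x
  have pos: "0 \<le> S t g x" if "\<And>x. 0 \<le> apply_bcontfun g x" for g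
    using S t that by (simp add: markov_semigroup_def)
  have "0 \<le> S t (const_bcontfun (norm f) - f) x" "0 \<le> S t (const_bcontfun (norm f) + f) x"
    by (rule pos; use norm_bounded[of f] in \<open>simp add: const_bcontfun.rep_eq abs_le_iff\<close>;
      metis add.commute minus_le_iff neg_le_iff_le diff_ge_0_iff_ge diff_minus_eq_add)+
  then show "norm (S t f x) \<le> norm f"
    by (simp add: linear_diff linear_add markov_linear[OF S t] markov_const[OF S t] const_bcontfun.rep_eq)
qed

text \<open>Keeps the segment u + s v, traversed during one Euler step, in the domain of the
  generator.\<close>

lemma generator_graph_lincomb:
  assumes S: "markov_semigroup S" and u: "(u, u') \<in> generator_graph S" and v: "(v, v') \<in> generator_graph S"
  shows "(u + s *\<^sub>R v, u' + s *\<^sub>R v') \<in> generator_graph S"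
proof -
  have "((\<lambda>t. (S t u - u) /\<^sub>R t + s *\<^sub>R ((S t v - v) /\<^sub>R t)) \<longlongrightarrow> u' + s *\<^sub>R v') (at_right 0)"
    using u v unfolding generator_graph_def by (intro tendsto_intros) auto
  moreover have "eventually (\<lambda>t. (S t u - u) /\<^sub>R t + s *\<^sub>R ((S t v - v) /\<^sub>R t)
      = (S t (u + s *\<^sub>R v) - (u + s *\<^sub>R v)) /\<^sub>R t) (at_right 0)"
    using eventually_at_right_less[of "0::real"]
    by eventually_elim (simp add: linear_add[OF markov_linear[OF S]] linear_scale[OF markov_linear[OF S]] algebra_simps)
  ultimately show ?thesis
    unfolding generator_graph_def mem_Collect_eq prod.case by (rule Lim_transform_eventually)
qed

text \<open>Only the right derivative of \<open>S\<close> at \<open>0\<close> is given. Both one-sided increments reduce to it, as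
  \<open>S (h - r)\<close> factors through \<open>S (h - s)\<close> or conversely.\<close>

lemma markov_path_derivative:
  fixes u :: "'a::topological_space \<Rightarrow>\<^sub>C real"
  assumes S: "markov_semigroup S" and u: "(u, u') \<in> generator_graph S" and v: "(v, v') \<in> generator_graph S"
    and s: "s \<in> {0..h}"
  shows "((\<lambda>r. S (h - r) (u + r *\<^sub>R v)) has_vector_derivative S (h - s) (v - (u' + s *\<^sub>R v')))
    (at s within {0..h})"
proof -
  define F where "F = (\<lambda>r. S (h - r) (u + r *\<^sub>R v))"
  define w where "w = u + s *\<^sub>R v"
  define w' where "w' = u' + s *\<^sub>R v'"
  define z where "z = v - w'"
  \<comment> \<open>\<open>E d\<close> gathers every error that vanishes with d: increments to the
    right use the first two terms, increments to the left the first and the third.\<close>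
  define E where "E = (\<lambda>d. norm ((S d w - w) /\<^sub>R d - w') + norm (S d z - z) + norm (S d v - v))"
  have w: "(w, w') \<in> generator_graph S"
    unfolding w_def w'_def by (rule generator_graph_lincomb[OF S u v])
  have cont: "((\<lambda>t. S t f) \<longlongrightarrow> f) (at_right 0)" for f
    using S by (simp add: markov_semigroup_def)
  have "(E \<longlongrightarrow> norm (w' - w') + norm (z - z) + norm (v - v)) (at_right 0)"
    unfolding E_def using w by (intro tendsto_intros cont) (simp add: generator_graph_def)
  then have E0: "(E \<longlongrightarrow> 0) (at_right 0)" by simp
  have "filterlim (\<lambda>r. \<bar>r - s\<bar>) (at_right 0) (at s within {0..h})"
    unfolding filterlim_at
  proof
    show "\<forall>\<^sub>F r in at s within {0..h}. \<bar>r - s\<bar> \<in> {0<..} \<and> \<bar>r - s\<bar> \<noteq> 0"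
      by (auto simp: eventually_at_filter)
    have "((\<lambda>r. \<bar>r - s\<bar>) \<longlongrightarrow> \<bar>s - s\<bar>) (at s within {0..h})" by (intro tendsto_intros)
    then show "((\<lambda>r. \<bar>r - s\<bar>) \<longlongrightarrow> 0) (at s within {0..h})" by simp
  qed
  then have Elim: "((\<lambda>r. E \<bar>r - s\<bar>) \<longlongrightarrow> 0) (at s within {0..h})"
    by (rule filterlim_compose[OF E0])
  have bound: "norm ((F r - F s) /\<^sub>R (r - s) - S (h - s) z) \<le> E \<bar>r - s\<bar>" if r: "r \<in> {0..h}" "r \<noteq> s" for r
  proof (cases "r > s")
    case True
    define d where "d = r - s"
    have d: "d > 0" and hr: "0 \<le> h - r" using True r by (auto simp: d_def)
    note lin = linear_diff[OF markov_linear[OF S hr]] linear_add[OF markov_linear[OF S hr]] linear_scale[OF markov_linear[OF S hr]]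
    have split: "S (h - s) f = S (h - r) (S d f)" for f
      using markov_semigroup_add[OF S hr less_imp_le[OF d], of f] by (simp add: d_def)
    have "u + r *\<^sub>R v = w + d *\<^sub>R v" by (simp add: w_def d_def algebra_simps)
    then have "(F r - F s) /\<^sub>R d - S (h - s) z = (S (h - r) (w + d *\<^sub>R v) - S (h - r) (S d w)) /\<^sub>R d - S (h - r) (S d z)"
      unfolding F_def by (simp only: split w_def[symmetric])
    also have "\<dots> = S (h - r) ((w + d *\<^sub>R v - S d w) /\<^sub>R d - S d z)"
      by (simp add: lin)
    also have "(w + d *\<^sub>R v - S d w) /\<^sub>R d - S d z = - ((S d w - w) /\<^sub>R d - w') - (S d z - z)"
      using d by (simp add: z_def algebra_simps)
    finally have "norm ((F r - F s) /\<^sub>R d - S (h - s) z) \<le> norm (- ((S d w - w) /\<^sub>R d - w') - (S d z - z))"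
      using markov_contraction[OF S hr] by simp
    also have "\<dots> \<le> E d"
      unfolding E_def using norm_triangle_ineq4[of "- ((S d w - w) /\<^sub>R d - w')" "S d z - z"] norm_ge_zero[of "S d v - v"]
      unfolding norm_minus_cancel by linarith
    finally show ?thesis using True by (simp add: d_def)
  next
    case False
    define d where "d = s - r"
    have d: "d > 0" and hs: "0 \<le> h - s" using False r s by (auto simp: d_def)
    note lin = linear_diff[OF markov_linear[OF S hs]] linear_add[OF markov_linear[OF S hs]] linear_scale[OF markov_linear[OF S hs]]
    note lind = linear_diff[OF markov_linear[OF S less_imp_le[OF d]]] linear_scale[OF markov_linear[OF S less_imp_le[OF d]]]
    have split: "S (h - r) f = S (h - s) (S d f)" for f
      using markov_semigroup_add[OF S hs less_imp_le[OF d], of f] by (simp add: d_def)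
    have "u + r *\<^sub>R v = w - d *\<^sub>R v" by (simp add: w_def d_def algebra_simps)
    then have "(F r - F s) /\<^sub>R (- d) - S (h - s) z = (S (h - s) (S d (w - d *\<^sub>R v)) - S (h - s) w) /\<^sub>R (- d) - S (h - s) z"
      unfolding F_def by (simp only: split w_def[symmetric])
    also have "\<dots> = S (h - s) ((S d (w - d *\<^sub>R v) - w) /\<^sub>R (- d) - z)"
      by (simp only: lin)
    also have "(S d (w - d *\<^sub>R v) - w) /\<^sub>R (- d) - z = (S d v - v) - ((S d w - w) /\<^sub>R d - w')"
      using d by (simp add: z_def lind algebra_simps)
    finally have "norm ((F r - F s) /\<^sub>R (- d) - S (h - s) z) \<le> norm ((S d v - v) - ((S d w - w) /\<^sub>R d - w'))"
      using markov_contraction[OF S hs] by simp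
    also have "\<dots> \<le> E d"
      unfolding E_def using norm_triangle_ineq4[of "S d v - v" "(S d w - w) /\<^sub>R d - w'"] norm_ge_zero[of "S d z - z"]
      by linarith
    finally show ?thesis using False by (simp add: d_def)
  qed
  have quot: "norm (F r - F s - (r - s) *\<^sub>R S (h - s) z) / norm (r - s) = norm ((F r - F s) /\<^sub>R (r - s) - S (h - s) z)"
    if "r \<noteq> s" for r
  proof -
    have "(F r - F s) /\<^sub>R (r - s) - S (h - s) z = (F r - F s - (r - s) *\<^sub>R S (h - s) z) /\<^sub>R (r - s)"
      using that by (simp add: scaleR_diff_right)
    then show ?thesis by (simp add: divide_inverse_commute)
  qed
  have "((\<lambda>r. norm (F r - F s - (r - s) *\<^sub>R S (h - s) z) / norm (r - s)) \<longlongrightarrow> 0) (at s within {0..h})"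
    by (rule Lim_null_comparison[OF _ Elim]) (use bound quot in \<open>auto simp: eventually_at_filter\<close>)
  then show ?thesis
    unfolding has_vector_derivative_def has_derivative_iff_norm
      F_def[symmetric] w'_def[symmetric] z_def[symmetric]
    by (simp add: bounded_linear_scaleR_left)
qed

text \<open>Duhamel's argument: the path S (h - r) (u + r v) runs from S h u at r = 0 to u + h v at
  r = h. By contraction its speed is at most the norm of the defect between v and the generator at u
  + s v.\<close>

lemma markov_euler_step:
  fixes u :: "'a::topological_space \<Rightarrow>\<^sub>C real"
  assumes S: "markov_semigroup S" and u: "(u, u') \<in> generator_graph S" and v: "(v, v') \<in> generator_graph S"
    and h: "0 \<le> h" and B: "\<And>s. 0 \<le> s \<Longrightarrow> s \<le> h \<Longrightarrow> norm (v - (u' + s *\<^sub>R v')) \<le> B"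
  shows "norm (u + h *\<^sub>R v - S h u) \<le> h * B"
proof -
  define F where "F = (\<lambda>r. S (h - r) (u + r *\<^sub>R v))"
  have "norm (F h - F 0) \<le> B * norm (h - 0)"
  proof (rule differentiable_bound[where S = "{0..h}"])
    fix s assume s: "s \<in> {0..h}"
    show "(F has_derivative (\<lambda>r. r *\<^sub>R S (h - s) (v - (u' + s *\<^sub>R v')))) (at s within {0..h})"
      using markov_path_derivative[OF S u v s] unfolding F_def has_vector_derivative_def .
    have "norm (S (h - s) (v - (u' + s *\<^sub>R v'))) \<le> B"
      using order_trans[OF markov_contraction[OF S] B] s by simp
    then show "onorm (\<lambda>r. r *\<^sub>R S (h - s) (v - (u' + s *\<^sub>R v'))) \<le> B"
      by (intro onorm_le) (simp add: mult.commute[of B] mult_left_mono)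
  qed (use h in auto)
  moreover have "F h = u + h *\<^sub>R v" "F 0 = S h u"
    using S by (simp_all add: F_def markov_semigroup_def)
  ultimately show ?thesis using h by (simp add: mult.commute)
qed

text \<open>Errors of single steps only add up, since later applications of the contraction S h do
  not enlarge them.\<close>

lemma markov_euler_error:
  fixes u :: "nat \<Rightarrow> 'a::topological_space \<Rightarrow>\<^sub>C real"
  assumes S: "markov_semigroup S" and h: "0 \<le> h"
    and step: "\<And>j. j < k \<Longrightarrow> norm (u (Suc j) - S h (u j)) \<le> e"
  shows "norm (u k - S (real k * h) (u 0)) \<le> real k * e"
  using step
proof (induction k)
  case 0
  then show ?case using S by (simp add: markov_semigroup_def)
next
  case (Suc k)
  have "S (real (Suc k) * h) (u 0) = S h (S (real k * h) (u 0))"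
    using markov_semigroup_add[OF S h, of "real k * h" "u 0"] h by (simp add: algebra_simps)
  then have "u (Suc k) - S (real (Suc k) * h) (u 0)
      = (u (Suc k) - S h (u k)) + S h (u k - S (real k * h) (u 0))"
    by (simp add: linear_diff[OF markov_linear[OF S h]])
  also have "norm \<dots> \<le> norm (u (Suc k) - S h (u k)) + norm (u k - S (real k * h) (u 0))"
    by (rule norm_triangle_le) (simp add: markov_contraction[OF S h])
  also have "\<dots> \<le> e + real k * e"
    using Suc.prems[of k] Suc.IH Suc.prems by (intro add_mono) auto
  finally show ?case by (simp add: algebra_simps)
qed

subsection \<open>Oscillations under Euler steps\<close>

text \<open>Gives the sums in the definitions access to monotone convergence and Tonelli.
  Countability provides the exhaustion by finite sets \<open>?F n\<close>.\<close>

lemma infsum_eq_nn_integral_count_space: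
  fixes f :: "'a::countable \<Rightarrow> ennreal"
  shows "infsum f UNIV = (\<integral>\<^sup>+x. f x \<partial>count_space UNIV)"
proof (rule antisym)
  have le: "sum f F \<le> (\<integral>\<^sup>+x. f x \<partial>count_space UNIV)" if "finite F" for F
  proof -
    have "sum f F = (\<integral>\<^sup>+x. f x * indicator F x \<partial>count_space UNIV)"
      using that by (simp add: nn_integral_count_space_finite flip: nn_integral_count_space_indicator)
    also have "\<dots> \<le> (\<integral>\<^sup>+x. f x \<partial>count_space UNIV)"
      by (intro nn_integral_mono) (auto simp: indicator_def)
    finally show ?thesis .
  qed
  then show "infsum f UNIV \<le> (\<integral>\<^sup>+x. f x \<partial>count_space UNIV)"
    by (simp add: nonneg_infsum_complete SUP_le_iff)
  let ?F = "\<lambda>n. {x :: 'a. to_nat x < n}"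
  have fin: "finite (?F n)" for n
    by (rule finite_imageD[where f = to_nat]) (auto intro: finite_subset[of _ "{..<n}"] simp: inj_on_def)
  have "(\<integral>\<^sup>+x. f x \<partial>count_space UNIV) = (\<integral>\<^sup>+x. (SUP n. f x * indicator (?F n) x) \<partial>count_space UNIV)"
  proof (rule nn_integral_cong)
    fix x
    have "(SUP n. f x * indicator (?F n) x) = f x"
    proof (rule antisym)
      show "(SUP n. f x * indicator (?F n) x) \<le> f x"
        by (rule SUP_least) (simp add: indicator_def)
      show "f x \<le> (SUP n. f x * indicator (?F n) x)"
        by (rule SUP_upper2[of "Suc (to_nat x)"]) auto
    qed
    then show "f x = (SUP n. f x * indicator (?F n) x)" ..
  qed
  also have "\<dots> = (SUP n. \<integral>\<^sup>+x. f x * indicator (?F n) x \<partial>count_space UNIV)"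
    by (rule nn_integral_monotone_convergence_SUP) (auto simp: incseq_def le_fun_def indicator_def)
  also have "\<dots> \<le> infsum f UNIV"
    using fin by (intro SUP_least)
      (simp add: nn_integral_count_space_finite finite_sum_le_infsum_ennreal flip: nn_integral_count_space_indicator)
  finally show "(\<integral>\<^sup>+x. f x \<partial>count_space UNIV) \<le> infsum f UNIV" .
qed

lemma infsum_ennreal_real:
  assumes "\<And>x. 0 \<le> f x" "f summable_on UNIV"
  shows "infsum (\<lambda>x. ennreal (f x)) UNIV = ennreal (infsum f UNIV)"
proof -
  have "(f has_sum infsum f UNIV) UNIV" using assms(2) by (rule has_sum_infsum)
  then have "((\<lambda>F. ennreal (sum f F)) \<longlongrightarrow> ennreal (infsum f UNIV)) (finite_subsets_at_top UNIV)"
    unfolding has_sum_def by (rule tendsto_ennrealI)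
  then have "((\<lambda>x. ennreal (f x)) has_sum ennreal (infsum f UNIV)) UNIV"
    unfolding has_sum_def sum_ennreal[OF assms(1)] .
  then show ?thesis by (rule infsumI)
qed

lemma infsum_ennreal_bound:
  assumes "\<And>x. 0 \<le> f x" "0 \<le> K" "infsum (\<lambda>x. ennreal (f x)) UNIV \<le> ennreal K"
  shows "f summable_on UNIV" "infsum f UNIV \<le> K"
proof -
  have "sum f F \<le> K" if "finite F" for F
  proof -
    have "ennreal (sum f F) \<le> ennreal K"
      using order_trans[OF finite_sum_le_infsum_ennreal[OF that, of UNIV "\<lambda>x. ennreal (f x)"] assms(3)] assms(1)
      by simp
    then show ?thesis using assms(2) by simp
  qed
  then show "f summable_on UNIV" using assms(1)
    by (intro nonneg_bdd_above_summable_on bdd_aboveI2[where M = K]) auto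
  then show "infsum f UNIV \<le> K"
    using \<open>\<And>F. finite F \<Longrightarrow> sum f F \<le> K\<close> by (intro infsum_le_finite_sums) auto
qed

section \<open>Contraction and growth of oscillations for one Euler step\<close>

definition euler :: "('s, 'q::topological_space) rates \<Rightarrow> 's set set \<Rightarrow> real \<Rightarrow> ('s, 'q) obs \<Rightarrow> ('s, 'q) obs" where
  "euler c A h f = f + h *\<^sub>R gen c A f"

text \<open>The step condition makes \<open>euler c A h f \<eta>\<close> a convex combination of values of \<open>f\<close>.\<close>

definition admissible_step :: "('s, 'q::topological_space) rates \<Rightarrow> 's set set \<Rightarrow> real \<Rightarrow> bool" where
  "admissible_step c A h \<longleftrightarrow> finite A \<and> A \<subseteq> {\<Delta>. finite \<Delta>} \<and> 0 \<le> h \<and> h * (\<Sum>\<Delta>\<in>A. rate_bound c \<Delta>) \<le> 1"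

lemma apply_gen:
  fixes c :: "('s, 'q::{finite, topological_space}) rates"
  assumes "finite A" "A \<subseteq> {\<Delta>. finite \<Delta>}"
  shows "apply_bcontfun (gen c A f) \<eta>
    = (\<Sum>(\<Delta>, \<xi>)\<in>Sigma A local_configs. c \<Delta> \<xi> \<eta> * (f (override_on \<eta> \<xi> \<Delta>) - f \<eta>))"
  using assms by (subst sum.Sigma[symmetric]) (auto simp: gen_def apply_bcontfun_sum apply_jump)

lemma total_rate:
  fixes c :: "('s, 'q::{finite, topological_space}) rates"
  assumes c: "rates_nonneg c" and A: "admissible_step c A h"
  shows "0 \<le> (\<Sum>(\<Delta>, \<xi>)\<in>Sigma A local_configs. c \<Delta> \<xi> \<eta>)"
    and "h * (\<Sum>(\<Delta>, \<xi>)\<in>Sigma A local_configs. c \<Delta> \<xi> \<eta>) \<le> 1"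
proof -
  show "0 \<le> (\<Sum>(\<Delta>, \<xi>)\<in>Sigma A local_configs. c \<Delta> \<xi> \<eta>)"
    using c A by (intro sum_nonneg) (auto simp: rates_nonneg_def admissible_step_def)
  have "(\<Sum>(\<Delta>, \<xi>)\<in>Sigma A local_configs. c \<Delta> \<xi> \<eta>) = (\<Sum>\<Delta>\<in>A. \<Sum>\<xi>\<in>local_configs \<Delta>. c \<Delta> \<xi> \<eta>)"
    using A by (subst sum.Sigma) (auto simp: admissible_step_def)
  also have "\<dots> \<le> (\<Sum>\<Delta>\<in>A. rate_bound c \<Delta>)"
    unfolding rate_bound_def using norm_bounded[of "c _ _" \<eta>] by (intro sum_mono) (auto intro: order_trans[OF abs_ge_self])
  finally show "h * (\<Sum>(\<Delta>, \<xi>)\<in>Sigma A local_configs. c \<Delta> \<xi> \<eta>) \<le> 1"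
    using A by (meson admissible_step_def mult_left_mono order_trans)
qed

lemma norm_euler_le:
  fixes c :: "('s, 'q::{finite, topological_space}) rates"
  assumes c: "rates_nonneg c" and A: "admissible_step c A h"
  shows "norm (euler c A h f) \<le> norm f"
proof (rule norm_bound)
  fix \<eta>
  let ?I = "Sigma A (local_configs :: 's set \<Rightarrow> ('s \<Rightarrow> 'q) set)"
  define q where "q = (\<Sum>(\<Delta>, \<xi>)\<in>?I. c \<Delta> \<xi> \<eta>)"
  have q: "0 \<le> q" "h * q \<le> 1" using total_rate[OF c A] by (simp_all add: q_def)
  have h: "0 \<le> h" using A by (simp add: admissible_step_def)
  have c0: "0 \<le> c \<Delta> \<xi> \<eta>" if "\<Delta> \<in> A" "\<xi> \<in> local_configs \<Delta>" for \<Delta> \<xi>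
    using c A that by (auto simp: rates_nonneg_def admissible_step_def)
  have "euler c A h f \<eta> = (1 - h * q) * f \<eta> + h * (\<Sum>(\<Delta>, \<xi>)\<in>?I. c \<Delta> \<xi> \<eta> * f (override_on \<eta> \<xi> \<Delta>))"
    using A by (simp add: euler_def apply_gen admissible_step_def q_def algebra_simps sum_subtractf
        sum_distrib_left case_prod_beta)
  also have "\<bar>\<dots>\<bar> \<le> (1 - h * q) * norm f + h * (q * norm f)"
  proof (rule order_trans[OF abs_triangle_ineq add_mono])
    show "\<bar>(1 - h * q) * f \<eta>\<bar> \<le> (1 - h * q) * norm f"
      using q norm_bounded[of f \<eta>] by (auto simp: abs_mult intro!: mult_left_mono)
    have "\<bar>\<Sum>(\<Delta>, \<xi>)\<in>?I. c \<Delta> \<xi> \<eta> * f (override_on \<eta> \<xi> \<Delta>)\<bar>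
        \<le> (\<Sum>(\<Delta>, \<xi>)\<in>?I. c \<Delta> \<xi> \<eta> * norm f)"
      using c0 norm_bounded[of f]
      by (intro order_trans[OF sum_abs] sum_mono) (auto simp: abs_mult intro!: mult_mono)
    then show "\<bar>h * (\<Sum>(\<Delta>, \<xi>)\<in>?I. c \<Delta> \<xi> \<eta> * f (override_on \<eta> \<xi> \<Delta>))\<bar> \<le> h * (q * norm f)"
      using h by (auto simp: abs_mult q_def sum_distrib_right case_prod_beta intro!: mult_left_mono)
  qed
  finally show "norm (euler c A h f \<eta>) \<le> norm f" by (simp add: algebra_simps)
qed

text \<open>If both configurations move with the rates at \<eta>, a step averages differences of f
  across x and cannot exceed \<open>osc x f\<close>. Replacing those rates by the ones at \<zeta>
  costs the oscillation of the rates times an increment of f over \<Delta>.\<close>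

lemma osc_euler_le:
  fixes c :: "('s, 'q::{finite, topological_space}) rates"
  assumes c: "rates_nonneg c" and A: "admissible_step c A h"
  shows "osc x (euler c A h f)
    \<le> osc x f + h * (\<Sum>\<Delta>\<in>A. (\<Sum>\<xi>\<in>local_configs \<Delta>. osc x (c \<Delta> \<xi>)) * (\<Sum>y\<in>\<Delta>. osc y f))"
proof (rule osc_least)
  fix \<eta> \<zeta> :: "'s \<Rightarrow> 'q" assume *: "\<And>y. y \<noteq> x \<Longrightarrow> \<eta> y = \<zeta> y"
  let ?I = "Sigma A (local_configs :: 's set \<Rightarrow> ('s \<Rightarrow> 'q) set)"
  define q where "q = (\<Sum>(\<Delta>, \<xi>)\<in>?I. c \<Delta> \<xi> \<eta>)"
  have q: "0 \<le> q" "h * q \<le> 1" using total_rate[OF c A] by (simp_all add: q_def)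
  have h: "0 \<le> h" using A by (simp add: admissible_step_def)
  have c0: "0 \<le> c \<Delta> \<xi> \<eta>" if "\<Delta> \<in> A" "\<xi> \<in> local_configs \<Delta>" for \<Delta> \<xi>
    using c A that by (auto simp: rates_nonneg_def admissible_step_def)
  have A': "finite A" "A \<subseteq> {\<Delta>. finite \<Delta>}" using A by (simp_all add: admissible_step_def)
  \<comment> \<open>\<open>X\<close> moves both configurations with the rates at \<eta>;
    \<open>Y\<close> collects the remaining differences of rates.\<close>
  define X where "X = (\<Sum>(\<Delta>, \<xi>)\<in>?I. c \<Delta> \<xi> \<eta> * (f (override_on \<eta> \<xi> \<Delta>) - f (override_on \<zeta> \<xi> \<Delta>)))"
  define Y where "Y = (\<Sum>(\<Delta>, \<xi>)\<in>?I. (c \<Delta> \<xi> \<eta> - c \<Delta> \<xi> \<zeta>) * (f (override_on \<zeta> \<xi> \<Delta>) - f \<zeta>))"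
  have gen_diff: "gen c A f \<eta> - gen c A f \<zeta> = X + Y - q * (f \<eta> - f \<zeta>)"
    unfolding X_def Y_def q_def apply_gen[OF A'] sum_distrib_right
      sum.distrib[symmetric] sum_subtractf[symmetric]
    by (rule sum.cong) (auto simp: algebra_simps)
  have euler_diff: "euler c A h f \<eta> - euler c A h f \<zeta> = f \<eta> - f \<zeta> + h * (gen c A f \<eta> - gen c A f \<zeta>)"
    by (simp add: euler_def algebra_simps)
  have "euler c A h f \<eta> - euler c A h f \<zeta> = (1 - h * q) * (f \<eta> - f \<zeta>) + h * X + h * Y"
    unfolding euler_diff gen_diff by (simp add: algebra_simps)
  also have "\<bar>\<dots>\<bar> \<le> \<bar>(1 - h * q) * (f \<eta> - f \<zeta>)\<bar> + \<bar>h * X\<bar> + \<bar>h * Y\<bar>"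
    by linarith
  also have "\<dots> \<le> (1 - h * q) * osc x f + h * (q * osc x f)
      + h * (\<Sum>\<Delta>\<in>A. (\<Sum>\<xi>\<in>local_configs \<Delta>. osc x (c \<Delta> \<xi>)) * (\<Sum>y\<in>\<Delta>. osc y f))"
  proof (intro add_mono)
    show "\<bar>(1 - h * q) * (f \<eta> - f \<zeta>)\<bar> \<le> (1 - h * q) * osc x f"
      using q osc_upper[of x \<eta> \<zeta> f, OF *] by (auto simp: abs_mult intro!: mult_left_mono)
    have "\<bar>f (override_on \<eta> \<xi> \<Delta>) - f (override_on \<zeta> \<xi> \<Delta>)\<bar> \<le> osc x f" for \<xi> \<Delta>
      by (rule osc_upper) (auto simp: override_on_def *)
    then have "\<bar>X\<bar> \<le> (\<Sum>(\<Delta>, \<xi>)\<in>?I. c \<Delta> \<xi> \<eta> * osc x f)"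
      unfolding X_def using c0
      by (intro order_trans[OF sum_abs] sum_mono) (auto simp: abs_mult intro!: mult_mono)
    then show "\<bar>h * X\<bar> \<le> h * (q * osc x f)"
      using h by (auto simp: abs_mult q_def sum_distrib_right case_prod_beta intro!: mult_left_mono)
    have "\<bar>Y\<bar> \<le> (\<Sum>(\<Delta>, \<xi>)\<in>?I. osc x (c \<Delta> \<xi>) * (\<Sum>y\<in>\<Delta>. osc y f))"
      unfolding Y_def using A' osc_upper[of x \<eta> \<zeta>, OF *]
      by (intro order_trans[OF sum_abs] sum_mono)
        (auto simp: abs_mult intro!: mult_mono osc_finite_change)
    also have "\<dots> = (\<Sum>\<Delta>\<in>A. (\<Sum>\<xi>\<in>local_configs \<Delta>. osc x (c \<Delta> \<xi>)) * (\<Sum>y\<in>\<Delta>. osc y f))"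
      using A' by (subst sum.Sigma[symmetric]) (auto simp: sum_distrib_right)
    finally show "\<bar>h * Y\<bar> \<le> h * (\<Sum>\<Delta>\<in>A. (\<Sum>\<xi>\<in>local_configs \<Delta>. osc x (c \<Delta> \<xi>)) * (\<Sum>y\<in>\<Delta>. osc y f))"
      using h by (auto simp: abs_mult intro!: mult_left_mono)
  qed
  finally show "\<bar>euler c A h f \<eta> - euler c A h f \<zeta>\<bar>
      \<le> osc x f + h * (\<Sum>\<Delta>\<in>A. (\<Sum>\<xi>\<in>local_configs \<Delta>. osc x (c \<Delta> \<xi>)) * (\<Sum>y\<in>\<Delta>. osc y f))"
    by (simp add: algebra_simps)
qed

text \<open>The matrix of \<open>gamma_rate\<close> with its diagonal kept, since the rate of a set
  containing x may itself depend on x. The first index is the updated site, the second the site on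
  which the rates depend.\<close>

definition influence :: "('s, 'q::topological_space) rates \<Rightarrow> 's \<Rightarrow> 's \<Rightarrow> ennreal" where
  "influence c y x = (\<Sum>\<^sub>\<infinity>\<Delta>\<in>{\<Delta>. finite \<Delta> \<and> y \<in> \<Delta>}. \<Sum>\<xi>\<in>local_configs \<Delta>. ennreal (osc x (c \<Delta> \<xi>)))"

text \<open>The transposed influence matrix, acting on vectors of oscillations.\<close>

definition spread :: "('s, 'q::topological_space) rates \<Rightarrow> ('s \<Rightarrow> ennreal) \<Rightarrow> 's \<Rightarrow> ennreal" where
  "spread c a x = (\<integral>\<^sup>+y. influence c y x * a y \<partial>count_space UNIV)"

text \<open>The resolvent \<open>(1 - \<theta> * spread)\<^sup>-\<^sup>1 a\<close>: one Euler step of size \<open>h\<close> enlarges it by at most the factor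
  \<open>1 + h / \<theta>\<close>, uniformly in the truncation.\<close>

definition majorant :: "('s, 'q::topological_space) rates \<Rightarrow> real \<Rightarrow> ('s \<Rightarrow> ennreal) \<Rightarrow> 's \<Rightarrow> ennreal" where
  "majorant c \<theta> a x = (\<Sum>k. ennreal \<theta> ^ k * (spread c ^^ k) a x)"

lemma le_majorant: "a x \<le> majorant c \<theta> a x"
  using sum_le_suminf[of "\<lambda>k. ennreal \<theta> ^ k * (spread c ^^ k) a x" "{0}"]
  by (simp add: majorant_def)

lemma spread_mono: "(\<And>y. a y \<le> b y) \<Longrightarrow> spread c a x \<le> spread c b x"
  unfolding spread_def by (intro nn_integral_mono mult_left_mono) auto

lemma spread_cmult: "spread c (\<lambda>y. K * a y) x = K * spread c a x"
  unfolding spread_def by (subst nn_integral_cmult[symmetric]) (auto simp: mult_ac)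

text \<open>Applying \<theta> times \<open>spread c\<close> shifts the series by one index, so only
  its zeroth term is lost.\<close>

lemma spread_majorant_le: "ennreal \<theta> * spread c (majorant c \<theta> a) x \<le> majorant c \<theta> a x"
proof -
  have "spread c (majorant c \<theta> a) x
      = (\<integral>\<^sup>+y. (\<Sum>k. influence c y x * (ennreal \<theta> ^ k * (spread c ^^ k) a y)) \<partial>count_space UNIV)"
    by (simp add: spread_def majorant_def)
  also have "\<dots> = (\<Sum>k. spread c (\<lambda>y. ennreal \<theta> ^ k * (spread c ^^ k) a y) x)"
    unfolding spread_def by (subst nn_integral_suminf) auto
  also have "\<dots> = (\<Sum>k. ennreal \<theta> ^ k * (spread c ^^ Suc k) a x)"
    by (simp add: spread_cmult)
  finally have "ennreal \<theta> * spread c (majorant c \<theta> a) x = (\<Sum>k. ennreal \<theta> ^ Suc k * (spread c ^^ Suc k) a x)"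
    by (simp add: mult_ac)
  also have "\<dots> \<le> majorant c \<theta> a x"
    unfolding majorant_def
  proof (rule suminf_le_const)
    fix n
    let ?F = "\<lambda>k. ennreal \<theta> ^ k * (spread c ^^ k) a x"
    have "(\<Sum>k<n. ?F (Suc k)) \<le> (\<Sum>k<Suc n. ?F k)"
      unfolding sum.lessThan_Suc_shift by (simp add: add_increasing)
    also have "\<dots> \<le> (\<Sum>k. ?F k)" by (rule sum_le_suminf) auto
    finally show "(\<Sum>k<n. ?F (Suc k)) \<le> (\<Sum>k. ?F k)" .
  qed simp
  finally show ?thesis .
qed

text \<open>Exchanging the sums over \<Delta> and y and completing the sum over A to all finite sets
  yields a bound free of the truncation.\<close>

lemma osc_euler_le_spread:
  fixes c :: "('s::countable, 'q::{finite, topological_space}) rates"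
  assumes c: "rates_nonneg c" and A: "admissible_step c A h"
  shows "ennreal (osc x (euler c A h f))
    \<le> ennreal (osc x f) + ennreal h * spread c (\<lambda>y. ennreal (osc y f)) x"
proof -
  have A': "finite A" "A \<subseteq> {\<Delta>. finite \<Delta>}" "0 \<le> h" using A by (simp_all add: admissible_step_def)
  then have fin: "finite (\<Union>A)" by auto
  let ?q = "\<lambda>\<Delta>. \<Sum>\<xi>\<in>local_configs \<Delta>. osc x (c \<Delta> \<xi>)"
  have q0: "0 \<le> ?q \<Delta>" for \<Delta> by (simp add: sum_nonneg)
  have "(\<Sum>\<Delta>\<in>A. ?q \<Delta> * (\<Sum>y\<in>\<Delta>. osc y f)) = (\<Sum>\<Delta>\<in>A. \<Sum>y | y \<in> \<Union>A \<and> y \<in> \<Delta>. ?q \<Delta> * osc y f)"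
    by (intro sum.cong refl) (auto simp: sum_distrib_left intro!: sum.cong)
  also have "\<dots> = (\<Sum>y\<in>\<Union>A. \<Sum>\<Delta> | \<Delta> \<in> A \<and> y \<in> \<Delta>. ?q \<Delta> * osc y f)"
    by (rule sum.swap_restrict[OF A'(1) fin])
  also have "\<dots> = (\<Sum>y\<in>\<Union>A. (\<Sum>\<Delta> | \<Delta> \<in> A \<and> y \<in> \<Delta>. ?q \<Delta>) * osc y f)"
    by (simp add: sum_distrib_right)
  finally have "ennreal (\<Sum>\<Delta>\<in>A. ?q \<Delta> * (\<Sum>y\<in>\<Delta>. osc y f))
      = ennreal (\<Sum>y\<in>\<Union>A. (\<Sum>\<Delta> | \<Delta> \<in> A \<and> y \<in> \<Delta>. ?q \<Delta>) * osc y f)"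
    by simp
  also have "\<dots> = (\<Sum>y\<in>\<Union>A. (\<Sum>\<Delta> | \<Delta> \<in> A \<and> y \<in> \<Delta>. \<Sum>\<xi>\<in>local_configs \<Delta>. ennreal (osc x (c \<Delta> \<xi>))) * ennreal (osc y f))"
    using q0 by (simp add: sum_nonneg ennreal_mult flip: sum_ennreal)
  also have "\<dots> \<le> (\<Sum>y\<in>\<Union>A. influence c y x * ennreal (osc y f))"
    unfolding influence_def using A'
    by (intro sum_mono mult_right_mono finite_sum_le_infsum_ennreal) auto
  also have "\<dots> \<le> spread c (\<lambda>y. ennreal (osc y f)) x"
    unfolding spread_def infsum_eq_nn_integral_count_space[symmetric]
    by (rule finite_sum_le_infsum_ennreal[OF fin]) simp
  finally have *: "ennreal (\<Sum>\<Delta>\<in>A. ?q \<Delta> * (\<Sum>y\<in>\<Delta>. osc y f)) \<le> spread c (\<lambda>y. ennreal (osc y f)) x" .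
  have "ennreal (osc x (euler c A h f)) \<le> ennreal (osc x f + h * (\<Sum>\<Delta>\<in>A. ?q \<Delta> * (\<Sum>y\<in>\<Delta>. osc y f)))"
    by (rule ennreal_leI[OF osc_euler_le[OF c A]])
  also have "\<dots> = ennreal (osc x f) + ennreal h * ennreal (\<Sum>\<Delta>\<in>A. ?q \<Delta> * (\<Sum>y\<in>\<Delta>. osc y f))"
    using A' q0 by (simp add: sum_nonneg ennreal_plus ennreal_mult)
  also have "\<dots> \<le> ennreal (osc x f) + ennreal h * spread c (\<lambda>y. ennreal (osc y f)) x"
    by (intro add_left_mono mult_left_mono *) auto
  finally show ?thesis .
qed

lemma osc_euler_le_majorant:
  fixes c :: "('s::countable, 'q::{finite, topological_space}) rates"
  assumes c: "rates_nonneg c" and A: "admissible_step c A h" and \<theta>: "0 < \<theta>" and \<kappa>: "0 \<le> \<kappa>"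
    and b: "\<And>x. ennreal (osc x f) \<le> ennreal \<kappa> * majorant c \<theta> a x"
  shows "ennreal (osc x (euler c A h f)) \<le> ennreal (\<kappa> * (1 + h / \<theta>)) * majorant c \<theta> a x"
proof -
  have h: "0 \<le> h" using A by (simp add: admissible_step_def)
  \<comment> \<open>The step size is split as (h / \<theta>) \<theta>, the factor \<theta> being
    what \<open>spread_majorant_le\<close> absorbs.\<close>
  have eq: "ennreal (\<kappa> * h) = ennreal (\<kappa> * (h / \<theta>)) * ennreal \<theta>"
    using \<kappa> h \<theta> by (simp add: ennreal_mult'[symmetric])
  have "ennreal (osc x (euler c A h f)) \<le> ennreal (osc x f) + ennreal h * spread c (\<lambda>y. ennreal (osc y f)) x"
    by (rule osc_euler_le_spread[OF c A])
  also have "\<dots> \<le> ennreal \<kappa> * majorant c \<theta> a x + ennreal h * spread c (\<lambda>y. ennreal \<kappa> * majorant c \<theta> a y) x"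
    by (intro add_mono mult_left_mono spread_mono b) auto
  also have "\<dots> = ennreal \<kappa> * majorant c \<theta> a x + ennreal (\<kappa> * h) * spread c (majorant c \<theta> a) x"
    using \<kappa> h by (simp add: spread_cmult ennreal_mult mult_ac)
  also have "\<dots> \<le> ennreal \<kappa> * majorant c \<theta> a x + ennreal (\<kappa> * (h / \<theta>)) * majorant c \<theta> a x"
    unfolding eq mult.assoc by (intro add_left_mono mult_left_mono spread_majorant_le) auto
  also have "\<dots> = ennreal (\<kappa> * (1 + h / \<theta>)) * majorant c \<theta> a x"
    using \<kappa> h \<theta> ennreal_plus[of \<kappa> "\<kappa> * (h / \<theta>)"] by (simp add: distrib_left distrib_right)
  finally show ?thesis .
qed

lemma osc_euler_iterate_le:
  fixes c :: "('s::countable, 'q::{finite, topological_space}) rates"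
  assumes c: "rates_nonneg c" and A: "admissible_step c A h" and \<theta>: "0 < \<theta>"
  shows "ennreal (osc x ((euler c A h ^^ j) f))
    \<le> ennreal ((1 + h / \<theta>) ^ j) * majorant c \<theta> (\<lambda>y. ennreal (osc y f)) x"
proof (induction j arbitrary: x)
  case 0
  then show ?case using le_majorant[of "\<lambda>y. ennreal (osc y f)" x c \<theta>] by simp
next
  case (Suc j)
  have "0 \<le> h" using A by (simp add: admissible_step_def)
  then have "0 \<le> (1 + h / \<theta>) ^ j" using \<theta> by simp
  from osc_euler_le_majorant[OF c A \<theta> this Suc.IH]
  show ?case by (simp add: mult.commute)
qed

subsection \<open>Weighted influence bounds\<close>

text \<open>The diagonal is invisible to (R3), as \<open>gamma_rate\<close> vanishes there; it is
  controlled by (L1), because an oscillation is at most twice the supremum norm.\<close>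

lemma influence_diag_le: "influence c x x \<le> 2 * C_one c"
proof -
  have "(\<Sum>\<Delta>\<in>F. \<Sum>\<xi>\<in>local_configs \<Delta>. ennreal (osc x (c \<Delta> \<xi>))) \<le> 2 * C_one c"
    if F: "finite F" "F \<subseteq> {\<Delta>. finite \<Delta> \<and> x \<in> \<Delta>}" for F
  proof -
    have "ennreal (osc x (c \<Delta> \<xi>)) \<le> 2 * ennreal (norm (c \<Delta> \<xi>))" for \<Delta> \<xi>
      using ennreal_leI[OF osc_le_norm[of x "c \<Delta> \<xi>"]] by (simp add: ennreal_mult)
    then have "(\<Sum>\<Delta>\<in>F. \<Sum>\<xi>\<in>local_configs \<Delta>. ennreal (osc x (c \<Delta> \<xi>)))
        \<le> 2 * (\<Sum>\<Delta>\<in>F. \<Sum>\<xi>\<in>local_configs \<Delta>. ennreal (norm (c \<Delta> \<xi>)))"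
      unfolding sum_distrib_left by (intro sum_mono)
    also have "\<dots> \<le> 2 * (\<Sum>\<^sub>\<infinity>\<Delta>\<in>{\<Delta>. finite \<Delta> \<and> x \<in> \<Delta>}. \<Sum>\<xi>\<in>local_configs \<Delta>. ennreal (norm (c \<Delta> \<xi>)))"
      by (intro mult_left_mono finite_sum_le_infsum_ennreal F) auto
    also have "\<dots> \<le> 2 * C_one c"
      unfolding C_one_def by (intro mult_left_mono SUP_upper) auto
    finally show ?thesis .
  qed
  then show ?thesis
    unfolding influence_def by (subst nonneg_infsum_complete) (auto intro!: SUP_least)
qed

text \<open>Meaningful for \<open>\<Lambda> \<noteq> {}\<close> only; condition R2 makes it grow at most by the factor
  \<open>Cr / \<rho> (dist z x)\<close> from \<open>z\<close> to \<open>x\<close>, which is what the influence sums can absorb.\<close>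

definition weight :: "(real \<Rightarrow> real) \<Rightarrow> 's::metric_space set \<Rightarrow> 's \<Rightarrow> real" where
  "weight \<rho> \<Lambda> x = (INF u\<in>\<Lambda>. 1 / \<rho> (dist u x))"

section \<open>Constants and weighted sums under the rate conditions\<close>

locale weighted_rates =
  fixes c :: "('s::{metric_space, countable}, 'q::{finite, discrete_topology}) rates"
    and \<rho> :: "real \<Rightarrow> real"
  assumes rates_nonneg: "rates_nonneg c"
    and rho_pos: "\<And>r. 0 \<le> r \<Longrightarrow> 0 < \<rho> r"
    and L1: "C_one c < \<infinity>"
    and R2: "C_rho TYPE('s) \<rho> < \<infinity>"
    and R3: "C_gamma c \<rho> < \<infinity>"
begin

definition Cr :: real where "Cr = enn2real (C_rho TYPE('s) \<rho>)"

text \<open>Bounds the row sums of the influence matrix weighted by 1 / \<rho>: the first summand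
  for the off-diagonal entries, the second for the diagonal one.\<close>

definition M :: ennreal where "M = C_gamma c \<rho> + 2 * C_one c / ennreal (\<rho> 0)"

text \<open>Small enough that \<theta> \<open>Cr\<close> \<open>M\<close> is at most 1/2, so the
  resolvent series is dominated by a geometric one. The added 1 keeps the denominator positive when
  \<open>M\<close> is 0.\<close>

definition \<theta> :: real where "\<theta> = 1 / (2 * Cr * (enn2real M + 1))"

lemma rho_mult_le: "\<rho> (dist x z) * \<rho> (dist z y) \<le> Cr * \<rho> (dist x y)" for x y z :: 's
proof -
  have "ennreal (\<rho> (dist x z) * \<rho> (dist z y) / \<rho> (dist x y)) \<le> C_rho TYPE('s) \<rho>"
    unfolding C_rho_def by (rule SUP_upper2[of "(x, y, z)"]) auto
  also have "\<dots> = ennreal Cr" using R2 by (simp add: Cr_def less_top)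
  finally have "\<rho> (dist x z) * \<rho> (dist z y) / \<rho> (dist x y) \<le> Cr"
    by (simp add: Cr_def)
  then show ?thesis using rho_pos[of "dist x y"] by (simp add: pos_divide_le_eq)
qed

lemma Cr_pos: "0 < Cr"
proof -
  have "0 < \<rho> 0" by (rule rho_pos) simp
  then show ?thesis using rho_mult_le[of undefined undefined undefined] by simp
qed

lemma M_finite: "M < \<infinity>"
proof -
  have "2 * C_one c / ennreal (\<rho> 0) < \<infinity>"
    using L1 rho_pos[of 0] by (simp add: ennreal_divide_eq_top_iff ennreal_mult_eq_top_iff less_top[symmetric])
  then show ?thesis using R3 by (simp add: M_def)
qed

lemma theta_pos: "0 < \<theta>"
  using Cr_pos by (simp add: \<theta>_def add_nonneg_pos)

lemma theta_M_le: "ennreal \<theta> * (ennreal Cr * M) \<le> ennreal (1 / 2)"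
proof -
  have "M = ennreal (enn2real M)" using M_finite by simp
  then have "ennreal \<theta> * (ennreal Cr * M) = ennreal (\<theta> * (Cr * enn2real M))"
    using theta_pos Cr_pos by (metis enn2real_nonneg ennreal_mult less_imp_le mult_nonneg_nonneg)
  also have "\<theta> * (Cr * enn2real M) = enn2real M / (2 * (enn2real M + 1))"
    using Cr_pos by (simp add: \<theta>_def)
  also have "\<dots> \<le> 1 / 2"
    using enn2real_nonneg[of M] by (simp add: divide_simps add_nonneg_pos)
  finally show ?thesis by (simp add: ennreal_leI)
qed

lemma influence_sum_le: "(\<integral>\<^sup>+x. influence c y x / ennreal (\<rho> (dist y x)) \<partial>count_space UNIV) \<le> M"
proof -
  have "(\<integral>\<^sup>+x. influence c y x / ennreal (\<rho> (dist y x)) \<partial>count_space UNIV)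
     \<le> (\<integral>\<^sup>+x. gamma_rate c y x / ennreal (\<rho> (dist y x))
          + influence c y y / ennreal (\<rho> 0) * indicator {y} x \<partial>count_space UNIV)"
    by (rule nn_integral_mono) (auto simp: gamma_rate_def influence_def)
  also have "\<dots> = (\<integral>\<^sup>+x. gamma_rate c y x / ennreal (\<rho> (dist y x)) \<partial>count_space UNIV)
      + influence c y y / ennreal (\<rho> 0)"
    by (subst nn_integral_add) (auto simp: nn_integral_cmult_indicator)
  also have "\<dots> \<le> M"
    unfolding M_def infsum_eq_nn_integral_count_space[symmetric] C_gamma_def
    by (intro add_mono SUP_upper divide_right_mono_ennreal influence_diag_le) auto
  finally show ?thesis .
qed

context
  fixes w :: "'s \<Rightarrow> real"
  assumes w_nonneg: "\<And>x. 0 \<le> w x"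
    and w_transfer: "\<And>x z. w x * \<rho> (dist z x) \<le> Cr * w z"
begin

text \<open>By Tonelli the sum over x is taken first; the transfer condition then moves the weight
  from x to y, and the resulting factor 1 / \<rho> is absorbed by the weighted row sums. The
  constant weight 1 will give summability, \<open>weight \<rho> \<Lambda>\<close>
  localisation.\<close>

lemma spread_weighted_le:
  "(\<integral>\<^sup>+x. ennreal (w x) * spread c a x \<partial>count_space UNIV)
    \<le> ennreal Cr * M * (\<integral>\<^sup>+x. ennreal (w x) * a x \<partial>count_space UNIV)"
proof -
  have "(\<integral>\<^sup>+x. ennreal (w x) * spread c a x \<partial>count_space UNIV)
      = (\<integral>\<^sup>+x. \<integral>\<^sup>+y. ennreal (w x) * (influence c y x * a y) \<partial>count_space UNIV \<partial>count_space UNIV)"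
    unfolding spread_def by (simp add: nn_integral_cmult)
  also have "\<dots> = (\<integral>\<^sup>+y. \<integral>\<^sup>+x. ennreal (w x) * (influence c y x * a y) \<partial>count_space UNIV \<partial>count_space UNIV)"
    using nn_integral_fst_count_space[of "\<lambda>(x, y). ennreal (w x) * (influence c y x * a y)"]
      nn_integral_snd_count_space[of "\<lambda>(x, y). ennreal (w x) * (influence c y x * a y)"] by simp
  also have "\<dots> \<le> (\<integral>\<^sup>+y. ennreal Cr * M * (ennreal (w y) * a y) \<partial>count_space UNIV)"
  proof (rule nn_integral_mono)
    fix y
    have "(\<integral>\<^sup>+x. ennreal (w x) * (influence c y x * a y) \<partial>count_space UNIV)
        \<le> (\<integral>\<^sup>+x. (ennreal Cr * ennreal (w y) * a y) * (influence c y x / ennreal (\<rho> (dist y x))) \<partial>count_space UNIV)"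
    proof (rule nn_integral_mono)
      fix x
      let ?r = "\<rho> (dist y x)"
      have r: "0 < ?r" by (rule rho_pos) simp
      \<comment> \<open>The factor \<rho> is inserted and divided out: one copy joins
        \<open>w x\<close> for the transfer, the inverse stays with the influence.\<close>
      have "influence c y x = influence c y x * ennreal ?r / ennreal ?r"
        using r by (subst mult_divide_eq_ennreal) auto
      also have "\<dots> = ennreal ?r * (influence c y x / ennreal ?r)"
        unfolding ennreal_times_divide by (subst mult.commute) (rule refl)
      finally have "ennreal (w x) * (influence c y x * a y)
          = ennreal (w x) * (ennreal ?r * (influence c y x / ennreal ?r) * a y)"
        by simp
      also have "\<dots> = ennreal (w x * ?r) * a y * (influence c y x / ennreal ?r)"
        using r w_nonneg[of x] by (simp add: ennreal_mult mult_ac)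
      also have "\<dots> \<le> ennreal (Cr * w y) * a y * (influence c y x / ennreal ?r)"
        by (intro mult_right_mono ennreal_leI w_transfer) auto
      finally show "ennreal (w x) * (influence c y x * a y)
          \<le> (ennreal Cr * ennreal (w y) * a y) * (influence c y x / ennreal ?r)"
        using Cr_pos w_nonneg by (simp add: ennreal_mult)
    qed
    also have "\<dots> = (ennreal Cr * ennreal (w y) * a y) * (\<integral>\<^sup>+x. influence c y x / ennreal (\<rho> (dist y x)) \<partial>count_space UNIV)"
      by (rule nn_integral_cmult) simp
    also have "\<dots> \<le> (ennreal Cr * ennreal (w y) * a y) * M"
      by (intro mult_left_mono influence_sum_le) auto
    finally show "(\<integral>\<^sup>+x. ennreal (w x) * (influence c y x * a y) \<partial>count_space UNIV)
        \<le> ennreal Cr * M * (ennreal (w y) * a y)"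
      by (simp add: mult_ac)
  qed
  also have "\<dots> = ennreal Cr * M * (\<integral>\<^sup>+x. ennreal (w x) * a x \<partial>count_space UNIV)"
    by (rule nn_integral_cmult) simp
  finally show ?thesis .
qed

lemma spread_power_weighted_le:
  "(\<integral>\<^sup>+x. ennreal (w x) * (spread c ^^ k) a x \<partial>count_space UNIV)
    \<le> (ennreal Cr * M) ^ k * (\<integral>\<^sup>+x. ennreal (w x) * a x \<partial>count_space UNIV)"
proof (induction k)
  case (Suc k)
  have "(\<integral>\<^sup>+x. ennreal (w x) * (spread c ^^ Suc k) a x \<partial>count_space UNIV)
      \<le> ennreal Cr * M * (\<integral>\<^sup>+x. ennreal (w x) * (spread c ^^ k) a x \<partial>count_space UNIV)"
    using spread_weighted_le[of "(spread c ^^ k) a"] by simp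
  also have "\<dots> \<le> ennreal Cr * M * ((ennreal Cr * M) ^ k * (\<integral>\<^sup>+x. ennreal (w x) * a x \<partial>count_space UNIV))"
    by (intro mult_left_mono Suc.IH) auto
  finally show ?case by (simp add: mult_ac)
qed simp

text \<open>The k-th term of the resolvent series gains a factor at most (1/2)^k, and the geometric
  series sums to 2.\<close>

lemma majorant_weighted_le:
  "(\<integral>\<^sup>+x. ennreal (w x) * majorant c \<theta> a x \<partial>count_space UNIV)
    \<le> 2 * (\<integral>\<^sup>+x. ennreal (w x) * a x \<partial>count_space UNIV)"
proof -
  let ?W = "\<integral>\<^sup>+x. ennreal (w x) * a x \<partial>count_space UNIV"
  have "(\<integral>\<^sup>+x. ennreal (w x) * majorant c \<theta> a x \<partial>count_space UNIV)
      = (\<integral>\<^sup>+x. (\<Sum>k. ennreal \<theta> ^ k * (ennreal (w x) * (spread c ^^ k) a x)) \<partial>count_space UNIV)"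
    unfolding majorant_def by (simp add: mult_ac flip: ennreal_suminf_cmult)
  also have "\<dots> = (\<Sum>k. ennreal \<theta> ^ k * (\<integral>\<^sup>+x. ennreal (w x) * (spread c ^^ k) a x \<partial>count_space UNIV))"
    by (subst nn_integral_suminf) (auto simp: nn_integral_cmult)
  also have "\<dots> \<le> (\<Sum>k. ennreal ((1 / 2) ^ k) * ?W)"
  proof (rule suminf_le)
    fix k
    have "ennreal \<theta> ^ k * (\<integral>\<^sup>+x. ennreal (w x) * (spread c ^^ k) a x \<partial>count_space UNIV)
        \<le> ennreal \<theta> ^ k * ((ennreal Cr * M) ^ k * ?W)"
      by (intro mult_left_mono spread_power_weighted_le) auto
    also have "\<dots> = (ennreal \<theta> * (ennreal Cr * M)) ^ k * ?W"
      by (simp add: power_mult_distrib mult_ac)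
    also have "\<dots> \<le> ennreal (1 / 2) ^ k * ?W"
      by (intro mult_right_mono power_mono theta_M_le) auto
    finally show "ennreal \<theta> ^ k * (\<integral>\<^sup>+x. ennreal (w x) * (spread c ^^ k) a x \<partial>count_space UNIV)
        \<le> ennreal ((1 / 2) ^ k) * ?W"
      by (subst ennreal_power[symmetric]) auto
  qed auto
  also have "\<dots> = (\<Sum>k. ennreal ((1 / 2) ^ k)) * ?W"
    by simp
  also have "(\<Sum>k. ennreal ((1 / 2) ^ k)) = ennreal (\<Sum>k. (1 / 2) ^ k)"
    by (rule suminf_ennreal2) (auto intro: summable_geometric)
  also have "(\<Sum>k. (1 / 2 :: real) ^ k) = 2"
    by (subst suminf_geometric) auto
  finally show ?thesis by simp
qed

end

lemma weight_nonneg: "\<Lambda> \<noteq> {} \<Longrightarrow> 0 \<le> weight \<rho> \<Lambda> x"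
  unfolding weight_def by (rule cINF_greatest) (use rho_pos in \<open>auto simp: less_imp_le\<close>)

lemma weight_le: "u \<in> \<Lambda> \<Longrightarrow> weight \<rho> \<Lambda> x \<le> 1 / \<rho> (dist u x)"
  unfolding weight_def
  by (rule cINF_lower) (use rho_pos in \<open>auto simp: less_imp_le intro!: bdd_belowI2[where m = 0]\<close>)

text \<open>For each u in \<Lambda>, (R2) is applied to the route from u over z to x; the infimum
  over u comes last.\<close>

lemma weight_transfer:
  fixes \<Lambda> :: "'s set"
  assumes "\<Lambda> \<noteq> {}"
  shows "weight \<rho> \<Lambda> x * \<rho> (dist z x) \<le> Cr * weight \<rho> \<Lambda> z"
proof -
  have pos: "0 < \<rho> (dist u v)" for u v :: 's by (rule rho_pos) simp
  have "weight \<rho> \<Lambda> x * \<rho> (dist z x) / Cr \<le> weight \<rho> \<Lambda> z"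
    unfolding weight_def[of \<rho> \<Lambda> z]
  proof (rule cINF_greatest[OF assms])
    fix u assume "u \<in> \<Lambda>"
    have "weight \<rho> \<Lambda> x * (\<rho> (dist u z) * \<rho> (dist z x)) \<le> weight \<rho> \<Lambda> x * (Cr * \<rho> (dist u x))"
      by (intro mult_left_mono rho_mult_le weight_nonneg assms)
    also have "\<dots> \<le> 1 / \<rho> (dist u x) * (Cr * \<rho> (dist u x))"
      using Cr_pos pos[of u x] by (intro mult_right_mono weight_le[OF \<open>u \<in> \<Lambda>\<close>]) simp
    also have "\<dots> = Cr" using pos[of u x] by simp
    finally show "weight \<rho> \<Lambda> x * \<rho> (dist z x) / Cr \<le> 1 / \<rho> (dist u z)"
      using Cr_pos pos[of u z] by (simp add: divide_simps mult_ac)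
  qed
  then show ?thesis using Cr_pos by (simp add: pos_divide_le_eq mult.commute)
qed

text \<open>(R2) at coinciding points gives \<rho> 0 \<le> \<open>Cr\<close>. The factors 1 match
  the transfer condition for the constant weight.\<close>

lemma const_weight_transfer:
  fixes x z :: 's
  assumes "antimono_on {0..} \<rho>"
  shows "1 * \<rho> (dist z x) \<le> Cr * 1"
proof -
  have "\<rho> (dist z x) \<le> \<rho> 0"
    using assms by (auto simp: monotone_on_def)
  also have "\<rho> 0 \<le> Cr" using rho_mult_le[of x x x] rho_pos[of 0] by simp
  finally show ?thesis by simp
qed

text \<open>B is the resolvent applied to the oscillations of f. One B serves all truncations, step
  sizes and numbers of steps.\<close>

lemma oscillation_majorant:
  assumes anti: "antimono_on {0..} \<rho>" and f: "f \<in> D_space"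
  obtains B where "\<And>x. 0 \<le> B x" "B summable_on UNIV"
    "\<And>A h j x. admissible_step c A h \<Longrightarrow> osc x ((euler c A h ^^ j) f) \<le> (1 + h / \<theta>) ^ j * B x"
    "(\<lambda>x. weight \<rho> (dep_set f) x * B x) summable_on UNIV"
    "(\<Sum>\<^sub>\<infinity>x. weight \<rho> (dep_set f) x * B x) \<le> 2 / \<rho> 0 * tnorm f"
proof -
  let ?a = "\<lambda>x. ennreal (osc x f)" and ?w = "weight \<rho> (dep_set f)"
  let ?b = "majorant c \<theta> ?a"
  define B where "B x = enn2real (?b x)" for x
  have r0: "0 < \<rho> 0" by (rule rho_pos) simp
  have a: "(\<integral>\<^sup>+x. ?a x \<partial>count_space UNIV) = ennreal (tnorm f)"
    unfolding tnorm_def infsum_eq_nn_integral_count_space[symmetric]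
    by (rule infsum_ennreal_real[OF _ D_spaceD[OF f]]) simp
  have b: "(\<integral>\<^sup>+x. ?b x \<partial>count_space UNIV) \<le> ennreal (2 * tnorm f)"
    using majorant_weighted_le[of "\<lambda>_. 1" ?a, OF _ const_weight_transfer[OF anti]] a
    by (simp add: ennreal_mult)
  have fin: "?b x = ennreal (B x)" for x
  proof -
    have "?b x \<le> (\<integral>\<^sup>+x. ?b x \<partial>count_space UNIV)"
      by (rule nn_integral_ge_point) simp
    also note b
    finally have "?b x < top" using ennreal_less_top by (rule le_less_trans)
    then show ?thesis by (simp add: B_def)
  qed
  have B0: "0 \<le> B x" for x by (simp add: B_def)
  have wB: "(\<integral>\<^sup>+x. ennreal (?w x) * ?b x \<partial>count_space UNIV) \<le> ennreal (2 / \<rho> 0 * tnorm f)" if ne: "dep_set f \<noteq> {}"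
  proof -
    have "(\<integral>\<^sup>+x. ennreal (?w x) * ?b x \<partial>count_space UNIV)
        \<le> 2 * (\<integral>\<^sup>+x. ennreal (?w x) * ?a x \<partial>count_space UNIV)"
      by (rule majorant_weighted_le[OF weight_nonneg[OF ne] weight_transfer[OF ne]])
    \<comment> \<open>At a site of the dependence set the weight is at most 1 / \<rho> 0, by taking
      u = x in the infimum; elsewhere the oscillation is 0.\<close>
    also have "\<dots> \<le> 2 * (\<integral>\<^sup>+x. ennreal (1 / \<rho> 0) * ?a x \<partial>count_space UNIV)"
    proof (intro mult_left_mono nn_integral_mono)
      fix x
      show "ennreal (?w x) * ?a x \<le> ennreal (1 / \<rho> 0) * ?a x"
      proof (cases "x \<in> dep_set f")
        case True
        then show ?thesis using weight_le[OF True, of x] by (intro mult_right_mono ennreal_leI) auto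
      qed (simp add: dep_set_def)
    qed simp
    also have "\<dots> = ennreal (2 / \<rho> 0 * tnorm f)"
      using r0 ennreal_mult[of 2 "tnorm f / \<rho> 0"]
      by (subst nn_integral_cmult) (auto simp: a simp flip: ennreal_mult)
    finally show ?thesis .
  qed
  have B: "infsum (\<lambda>x. ennreal (B x)) UNIV \<le> ennreal (2 * tnorm f)"
    using b by (simp add: fin infsum_eq_nn_integral_count_space)
  have WB0: "0 \<le> ?w x * B x" and WB: "infsum (\<lambda>x. ennreal (?w x * B x)) UNIV \<le> ennreal (2 / \<rho> 0 * tnorm f)" for x
  proof -
    have "(\<forall>x. 0 \<le> ?w x * B x) \<and> infsum (\<lambda>x. ennreal (?w x * B x)) UNIV \<le> ennreal (2 / \<rho> 0 * tnorm f)"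
    \<comment> \<open>For an empty dependence set the weight is an infimum over the empty set, but
      then B vanishes identically.\<close>
    proof (cases "dep_set f = {}")
      case True
      then have "tnorm f = 0" by (simp add: dep_set_def tnorm_def)
      then have "?b x = 0" for x
        using order_trans[OF nn_integral_ge_point[of x UNIV ?b] b] by simp
      then show ?thesis by (simp add: B_def)
    next
      case False
      then show ?thesis
        using wB by (simp add: fin infsum_eq_nn_integral_count_space ennreal_mult weight_nonneg B0)
    qed
    then show "0 \<le> ?w x * B x" "infsum (\<lambda>x. ennreal (?w x * B x)) UNIV \<le> ennreal (2 / \<rho> 0 * tnorm f)"
      by auto
  qed
  show thesis
  proof (rule that[of B])
    show "B summable_on UNIV"
      by (rule infsum_ennreal_bound[OF B0 _ B]) simp
    show "(\<lambda>x. ?w x * B x) summable_on UNIV" "(\<Sum>\<^sub>\<infinity>x. ?w x * B x) \<le> 2 / \<rho> 0 * tnorm f"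
      using infsum_ennreal_bound[OF WB0 _ WB] r0 by auto
    show "osc x ((euler c A h ^^ j) f) \<le> (1 + h / \<theta>) ^ j * B x" if A: "admissible_step c A h" for A h j x
    proof -
      have "0 \<le> 1 + h / \<theta>" using A theta_pos by (simp add: admissible_step_def)
      then show ?thesis
        using osc_euler_iterate_le[OF rates_nonneg A theta_pos, of x j f] B0
        by (simp add: fin flip: ennreal_mult)
    qed
  qed (rule B0)
qed

end

subsection \<open>Convergence of the Euler scheme\<close>

lemma generator_graph_unique:
  "(f, h) \<in> generator_graph S \<Longrightarrow> (f, h') \<in> generator_graph S \<Longrightarrow> h = h'"
  unfolding generator_graph_def by (auto intro: tendsto_unique[rotated])

lemma euler_diff: "euler c A h (f - g) = euler c A h f - euler c A h g"
  using gen_add[of c A "f - g" g] by (simp add: euler_def algebra_simps)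

lemma norm_euler_iterate_le:
  fixes c :: "('s, 'q::{finite, topological_space}) rates"
  assumes "rates_nonneg c" "admissible_step c A h"
  shows "norm ((euler c A h ^^ k) f) \<le> norm f"
  by (induction k) (auto intro: order_trans[OF norm_euler_le[OF assms]])

text \<open>With P = 1 + h G the defect equals h (G(fg) - f Gg - g Gf) - h^2 Gf Gg. The first
  bracket is the carre du champ, a sum of products of increments over a common \<Delta>.\<close>

lemma euler_product_defect:
  fixes c :: "('s, 'q::{finite, topological_space}) rates"
  assumes c: "rates_nonneg c" and A: "admissible_step c A h"
  shows "norm (euler c A h (bc_mult f g) - bc_mult (euler c A h f) (euler c A h g))
    \<le> h * (\<Sum>\<Delta>\<in>A. rate_bound c \<Delta> * ((\<Sum>x\<in>\<Delta>. osc x f) * (\<Sum>y\<in>\<Delta>. osc y g)))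
      + h\<^sup>2 * (2 * (\<Sum>\<Delta>\<in>A. rate_bound c \<Delta>))\<^sup>2 * norm f * norm g"
proof (rule norm_bound)
  fix \<eta>
  let ?I = "Sigma A (local_configs :: 's set \<Rightarrow> ('s \<Rightarrow> 'q) set)"
  let ?N = "\<Sum>\<Delta>\<in>A. rate_bound c \<Delta>"
  let ?F = "\<lambda>\<Delta>. (\<Sum>x\<in>\<Delta>. osc x f) * (\<Sum>y\<in>\<Delta>. osc y g)"
  have A': "finite A" "A \<subseteq> {\<Delta>. finite \<Delta>}" and h: "0 \<le> h" using A by (simp_all add: admissible_step_def)
  define X where "X = (\<Sum>(\<Delta>, \<xi>)\<in>?I. c \<Delta> \<xi> \<eta> * ((f (override_on \<eta> \<xi> \<Delta>) - f \<eta>) * (g (override_on \<eta> \<xi> \<Delta>) - g \<eta>)))"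
  have "gen c A (bc_mult f g) \<eta> = X + f \<eta> * gen c A g \<eta> + g \<eta> * gen c A f \<eta>"
    unfolding X_def apply_gen[OF A'] sum_distrib_left sum.distrib[symmetric]
    by (rule sum.cong) (auto simp: algebra_simps)
  then have "euler c A h (bc_mult f g) \<eta> - euler c A h f \<eta> * euler c A h g \<eta>
      = h * X - h\<^sup>2 * (gen c A f \<eta> * gen c A g \<eta>)"
    by (simp add: euler_def power2_eq_square algebra_simps)
  also have "\<bar>\<dots>\<bar> \<le> h * (\<Sum>\<Delta>\<in>A. rate_bound c \<Delta> * ?F \<Delta>) + h\<^sup>2 * ((2 * ?N * norm f) * (2 * ?N * norm g))"
  proof (rule order_trans[OF abs_triangle_ineq4 add_mono])
    have "\<bar>X\<bar> \<le> (\<Sum>(\<Delta>, \<xi>)\<in>?I. norm (c \<Delta> \<xi>) * ?F \<Delta>)"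
      unfolding X_def using A' norm_bounded[of "c _ _" \<eta>]
      by (intro order_trans[OF sum_abs] sum_mono)
        (auto simp: abs_mult sum_nonneg intro!: mult_mono osc_finite_change)
    also have "\<dots> = (\<Sum>\<Delta>\<in>A. rate_bound c \<Delta> * ?F \<Delta>)"
      using A' by (subst sum.Sigma[symmetric]) (auto simp: rate_bound_def sum_distrib_right)
    finally show "\<bar>h * X\<bar> \<le> h * (\<Sum>\<Delta>\<in>A. rate_bound c \<Delta> * ?F \<Delta>)"
      using h by (simp add: abs_mult mult_left_mono)
    have "\<bar>gen c A f \<eta>\<bar> \<le> 2 * ?N * norm f" for f
      using order_trans[OF norm_bounded[of "gen c A f" \<eta>] norm_gen_norm] by simp
    then show "\<bar>h\<^sup>2 * (gen c A f \<eta> * gen c A g \<eta>)\<bar> \<le> h\<^sup>2 * ((2 * ?N * norm f) * (2 * ?N * norm g))"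
      unfolding abs_mult by (intro mult_mono mult_left_mono) (auto simp: sum_nonneg)
  qed
  finally show "norm ((euler c A h (bc_mult f g) - bc_mult (euler c A h f) (euler c A h g)) \<eta>)
      \<le> h * (\<Sum>\<Delta>\<in>A. rate_bound c \<Delta> * ?F \<Delta>) + h\<^sup>2 * (2 * ?N)\<^sup>2 * norm f * norm g"
    by (simp add: power2_eq_square mult_ac)
qed

text \<open>Telescoping: since the Euler step is a contraction, the defects of the k single steps
  merely add up.\<close>

lemma euler_iterate_product_defect:
  fixes c :: "('s, 'q::{finite, topological_space}) rates"
  assumes c: "rates_nonneg c" and A: "admissible_step c A h"
    and step: "\<And>j. j < k \<Longrightarrow> norm (euler c A h (bc_mult ((euler c A h ^^ j) f) ((euler c A h ^^ j) g))
      - bc_mult ((euler c A h ^^ Suc j) f) ((euler c A h ^^ Suc j) g)) \<le> e"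
  shows "norm ((euler c A h ^^ k) (bc_mult f g) - bc_mult ((euler c A h ^^ k) f) ((euler c A h ^^ k) g))
    \<le> real k * e"
  using step
proof (induction k)
  case (Suc k)
  let ?P = "euler c A h"
  let ?u = "(?P ^^ k) (bc_mult f g)" and ?v = "bc_mult ((?P ^^ k) f) ((?P ^^ k) g)"
  have "norm (?P ?u - ?P ?v) \<le> norm (?u - ?v)"
    using euler_diff[of c A h ?u ?v] norm_euler_le[OF c A, of "?u - ?v"] by simp
  also have "\<dots> \<le> real k * e" using Suc by simp
  finally have "norm (?P ?u - ?P ?v) + norm (?P ?v - bc_mult ((?P ^^ Suc k) f) ((?P ^^ Suc k) g)) \<le> real (Suc k) * e"
    using Suc.prems[of k] by (simp add: algebra_simps)
  then show ?case
    using norm_triangle_ineq[of "?P ?u - ?P ?v" "?P ?v - bc_mult ((?P ^^ Suc k) f) ((?P ^^ Suc k) g)"]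
    by simp
qed simp

section \<open>Distance between Euler iterates and the semigroup\<close>

context weighted_rates
begin

lemma power_step_le:
  assumes "0 \<le> t" "j \<le> k" "0 < k"
  shows "(1 + (t / real k) / \<theta>) ^ j \<le> exp (t / \<theta>)"
proof -
  have "(1 + (t / real k) / \<theta>) ^ j \<le> (1 + (t / real k) / \<theta>) ^ k"
    using assms theta_pos by (intro power_increasing) auto
  also have "\<dots> \<le> exp ((t / real k) / \<theta>) ^ k"
    using assms theta_pos by (intro power_mono) (auto intro: add_nonneg_nonneg)
  also have "\<dots> = exp (t / \<theta>)"
    using assms by (simp flip: exp_of_nat_mult)
  finally show ?thesis .
qed

text \<open>Each step errs by the neglected sets, measured by the tail outside A, and by freezing
  the generator during the step, which is of first order in t / k inside the bracket. Over k steps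
  of length t / k the prefactor becomes t.\<close>

lemma euler_semigroup_error:
  assumes gb: "generated_by S c" and k: "0 < k" and t: "0 < t"
    and A: "admissible_step c A (t / real k)"
    and B: "B summable_on UNIV" "\<And>j x. j \<le> k \<Longrightarrow> osc x ((euler c A (t / real k) ^^ j) f) \<le> B x"
  shows "norm ((euler c A (t / real k) ^^ k) f - S t f)
    \<le> t * ((\<Sum>\<^sub>\<infinity>\<Delta>\<in>{\<Delta>. finite \<Delta>} - A. rate_bound c \<Delta> * (\<Sum>x\<in>\<Delta>. B x))
      + t / real k * (2 * (\<Sum>\<Delta>\<in>A. rate_bound c \<Delta>))\<^sup>2 * norm f)"
proof -
  define h where "h = t / real k"
  have h: "0 < h" using k t by (simp add: h_def)
  let ?N = "\<Sum>\<Delta>\<in>A. rate_bound c \<Delta>"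
  let ?T = "\<Sum>\<^sub>\<infinity>\<Delta>\<in>{\<Delta>. finite \<Delta>} - A. rate_bound c \<Delta> * (\<Sum>x\<in>\<Delta>. B x)"
  note A = A[folded h_def] and B = B[folded h_def]
  have A': "finite A" "A \<subseteq> {\<Delta>. finite \<Delta>}" using A by (simp_all add: admissible_step_def)
  have S: "markov_semigroup S" using gb by (simp add: generated_by_def)
  have gr: "(f, full_gen c f) \<in> generator_graph S" if "f \<in> D_space" for f
    using gb full_gen_in_pregen_graph[OF L1 that] closure_subset
    by (auto simp: generated_by_def)
  have N: "0 \<le> ?N" by (simp add: sum_nonneg)
  define u where "u j = (euler c A h ^^ j) f" for j
  have uS: "u (Suc j) = u j + h *\<^sub>R gen c A (u j)" for j by (simp add: u_def euler_def)
  have uD: "u j \<in> D_space" if "j \<le> k" for j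
    using B that unfolding u_def by (intro D_spaceI[OF B(1)]) auto
  have step: "norm (u (Suc j) - S h (u j)) \<le> h * (?T + h * (2 * ?N)\<^sup>2 * norm f)" if j: "j < k" for j
    unfolding uS
  proof (rule markov_euler_step[OF S _ _ less_imp_le[OF h]])
    let ?v = "gen c A (u j)"
    \<comment> \<open>As a multiple of the difference of consecutive iterates, \<open>?v\<close> has
      summable oscillations.\<close>
    have "?v = (1 / h) *\<^sub>R (u (Suc j) + (- 1) *\<^sub>R u j)" using h by (simp add: uS)
    then have vD: "?v \<in> D_space" using j by (metis D_space_add D_space_scaleR Suc_leI less_imp_le uD)
    show "(u j, full_gen c (u j)) \<in> generator_graph S" "(?v, full_gen c ?v) \<in> generator_graph S"
      using j by (simp_all add: gr uD vD)
    fix s assume s: "0 \<le> s" "s \<le> h"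
    define w where "w = u j + s *\<^sub>R ?v"
    have wD: "w \<in> D_space" using vD uD j by (simp add: w_def D_space_add D_space_scaleR)
    \<comment> \<open>a convex combination of consecutive iterates, hence with oscillations still below \<open>B\<close>\<close>
    have w_eq: "w = (1 - s / h) *\<^sub>R u j + (s / h) *\<^sub>R u (Suc j)"
      using h by (simp add: w_def uS algebra_simps)
    have osc_w: "osc x w \<le> B x" for x
    proof -
      have "osc x w \<le> \<bar>1 - s / h\<bar> * osc x (u j) + \<bar>s / h\<bar> * osc x (u (Suc j))"
        unfolding w_eq by (rule order_trans[OF osc_add add_mono[OF osc_scaleR osc_scaleR]])
      also have "\<dots> \<le> (1 - s / h) * B x + (s / h) * B x"
        using s h j B(2) by (intro add_mono mult_mono) (auto simp: u_def simp del: funpow.simps)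
      finally show ?thesis by (simp add: algebra_simps)
    qed
    \<comment> \<open>Uniqueness of the generator's value at w turns this combination into
      \<open>full_gen c w\<close>.\<close>
    have "(w, full_gen c (u j) + s *\<^sub>R full_gen c ?v) \<in> generator_graph S"
      unfolding w_def using j by (intro generator_graph_lincomb[OF S] gr uD vD) auto
    then have "full_gen c (u j) + s *\<^sub>R full_gen c ?v = full_gen c w"
      using generator_graph_unique gr[OF wD] by blast
    then have "?v - (full_gen c (u j) + s *\<^sub>R full_gen c ?v) = - (full_gen c w - gen c A w) - s *\<^sub>R gen c A ?v"
      by (simp add: w_def gen_add gen_scaleR)
    also have "norm \<dots> \<le> norm (full_gen c w - gen c A w) + norm (s *\<^sub>R gen c A ?v)"
      using norm_triangle_ineq4[of "- (full_gen c w - gen c A w)"] unfolding norm_minus_cancel .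
    also have "norm (full_gen c w - gen c A w) \<le> ?T"
      by (rule norm_full_gen_diff_le[OF L1 wD A' osc_w B(1)])
    also have "norm (s *\<^sub>R gen c A ?v) \<le> h * (2 * ?N * (2 * ?N * norm f))"
    proof -
      have "norm ?v \<le> 2 * ?N * norm f"
        unfolding u_def
        by (rule order_trans[OF norm_gen_norm mult_left_mono[OF norm_euler_iterate_le[OF rates_nonneg A]]])
          (use N in simp)
      then have "norm (gen c A ?v) \<le> 2 * ?N * (2 * ?N * norm f)"
        by (rule order_trans[OF norm_gen_norm mult_left_mono]) (use N in simp)
      then show ?thesis using s by (auto intro: mult_mono)
    qed
    finally show "norm (?v - (full_gen c (u j) + s *\<^sub>R full_gen c ?v)) \<le> ?T + h * (2 * ?N)\<^sup>2 * norm f"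
      by (simp add: power2_eq_square mult_ac)
  qed
  from markov_euler_error[where u = u and k = k, OF S less_imp_le[OF h] step]
  have "norm (u k - S (real k * h) (u 0)) \<le> real k * h * (?T + h * (2 * ?N)\<^sup>2 * norm f)"
    by (simp add: mult.assoc)
  moreover have "real k * h = t" using k by (simp add: h_def)
  ultimately show ?thesis by (simp add: u_def h_def)
qed

lemma eventually_admissible:
  assumes "finite A" "A \<subseteq> {\<Delta>. finite \<Delta>}" "0 \<le> t"
  shows "eventually (\<lambda>k. admissible_step c A (t / real k)) sequentially"
proof -
  have "((\<lambda>k. t * (\<Sum>\<Delta>\<in>A. rate_bound c \<Delta>) / real k) \<longlongrightarrow> 0) sequentially"
    by (rule lim_const_over_n)
  then have "eventually (\<lambda>k. t * (\<Sum>\<Delta>\<in>A. rate_bound c \<Delta>) / real k < 1) sequentially"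
    by (rule order_tendstoD) simp
  then show ?thesis
    by eventually_elim (use assms in \<open>simp add: admissible_step_def\<close>)
qed

text \<open>The truncation A is fixed first and k is taken large afterwards, because the
  discretisation error contains the total rate of A, which may grow without bound with A.\<close>

lemma euler_tendsto_semigroup:
  assumes anti: "antimono_on {0..} \<rho>" and gb: "generated_by S c" and f: "f \<in> D_space"
    and t: "0 < t" and e: "0 < e"
  shows "eventually (\<lambda>A. eventually (\<lambda>k. norm ((euler c A (t / real k) ^^ k) f - S t f) < e) sequentially)
    (finite_subsets_at_top {\<Delta>. finite \<Delta>})"
proof -
  obtain B where B: "\<And>x. 0 \<le> B x" "B summable_on UNIV"
    "\<And>A h j x. admissible_step c A h \<Longrightarrow> osc x ((euler c A h ^^ j) f) \<le> (1 + h / \<theta>) ^ j * B x"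
    using oscillation_majorant[OF anti f] by metis
  \<comment> \<open>The factor exp (t / \<theta>) makes b dominate the oscillations of all iterates
    up to time t.\<close>
  define b where "b x = exp (t / \<theta>) * B x" for x
  have b: "0 \<le> b x" "b summable_on UNIV" for x
    unfolding b_def using B by (auto intro: summable_on_cmult_right)
  let ?T = "\<lambda>A. \<Sum>\<^sub>\<infinity>\<Delta>\<in>{\<Delta>. finite \<Delta>} - A. rate_bound c \<Delta> * (\<Sum>x\<in>\<Delta>. b x)"
  have "((\<lambda>A. t * ?T A) \<longlongrightarrow> t * 0) (finite_subsets_at_top {\<Delta>. finite \<Delta>})"
    by (intro tendsto_intros tail_tendsto_0 summable_rate_bound_sites L1 b)
  then have "eventually (\<lambda>A. t * ?T A < e / 2) (finite_subsets_at_top {\<Delta>. finite \<Delta>})"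
    by (rule order_tendstoD) (use e in simp)
  moreover have "eventually (\<lambda>A. finite A \<and> A \<subseteq> {\<Delta>. finite \<Delta>}) (finite_subsets_at_top {\<Delta> :: 's set. finite \<Delta>})"
    by (rule eventually_finite_subsets_at_top_weakI) auto
  ultimately show ?thesis
  proof eventually_elim
    case (elim A)
    let ?C = "t * (t * (2 * (\<Sum>\<Delta>\<in>A. rate_bound c \<Delta>))\<^sup>2 * norm f)"
    have "eventually (\<lambda>k. ?C / real k < e / 2) sequentially"
      by (rule order_tendstoD(2)[OF lim_const_over_n]) (use e in simp)
    moreover have "eventually (\<lambda>k. admissible_step c A (t / real k)) sequentially"
      using elim t by (intro eventually_admissible) auto
    moreover have "eventually (\<lambda>k. 0 < k) sequentially" by (rule eventually_gt_at_top)
    ultimately show ?case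
    proof eventually_elim
      case k: (elim k)
      have "osc x ((euler c A (t / real k) ^^ j) f) \<le> b x" if "j \<le> k" for j x
        using order_trans[OF B(3)[OF k(2)] mult_right_mono[OF power_step_le[OF less_imp_le[OF t] that k(3)] B(1)]]
        by (simp add: b_def)
      from euler_semigroup_error[OF gb k(3) t k(2) b(2) this]
      have "norm ((euler c A (t / real k) ^^ k) f - S t f) \<le> t * ?T A + ?C / real k"
        by (simp add: algebra_simps)
      with elim(1) k(1) show ?case by simp
    qed
  qed
qed

end

subsection \<open>Growth bound for covariances\<close>

context weighted_rates
begin

text \<open>Apply (R2) twice along the route u, x, y, v, whose ends are at least D apart while its
  middle piece is at most L. Sites within distance L thus have a product of weights of order at
  least 1 / \<rho> D.\<close>

lemma separated_weights:
  fixes x y :: 's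
  assumes anti: "antimono_on {0..} \<rho>" and ne: "\<Lambda> \<noteq> {}" "\<Lambda>' \<noteq> {}" and D: "0 \<le> D"
    and sep: "\<And>u v. u \<in> \<Lambda> \<Longrightarrow> v \<in> \<Lambda>' \<Longrightarrow> D \<le> dist u v" and xy: "dist x y \<le> L"
  shows "\<rho> L \<le> Cr\<^sup>2 * \<rho> D * (weight \<rho> \<Lambda> x * weight \<rho> \<Lambda>' y)"
proof -
  have pos: "0 < \<rho> (dist u v)" for u v :: 's by (rule rho_pos) simp
  have L: "0 \<le> L" using xy zero_le_dist order_trans by blast
  \<comment> \<open>The lower bound to be shown for the product of the two weights.\<close>
  define Z where "Z = \<rho> L / (Cr\<^sup>2 * \<rho> D)"
  have Z: "0 < Z" using Cr_pos rho_pos[OF D] rho_pos[OF L] by (simp add: Z_def)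
  have *: "Z * \<rho> (dist u x) \<le> 1 / \<rho> (dist v y)" if uv: "u \<in> \<Lambda>" "v \<in> \<Lambda>'" for u v
  proof -
    have "\<rho> (dist u x) * \<rho> L * \<rho> (dist v y) \<le> \<rho> (dist u x) * \<rho> (dist x y) * \<rho> (dist v y)"
      using anti xy L pos by (intro mult_right_mono mult_left_mono) (auto simp: monotone_on_def less_imp_le)
    also have "\<dots> \<le> (Cr * \<rho> (dist u y)) * \<rho> (dist y v)"
      using rho_mult_le[of u x y] pos[of y v] by (simp add: dist_commute mult_right_mono)
    also have "\<dots> \<le> Cr * (Cr * \<rho> (dist u v))"
      unfolding mult.assoc using Cr_pos by (intro mult_left_mono rho_mult_le) auto
    also have "\<dots> \<le> Cr * (Cr * \<rho> D)"
      using anti D sep[OF uv] Cr_pos by (intro mult_left_mono) (auto simp: monotone_on_def)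
    finally show ?thesis
      using pos[of v y] Cr_pos rho_pos[OF D]
      by (simp add: Z_def divide_simps power2_eq_square mult_ac)
  qed
  \<comment> \<open>The infimum over v comes first; it also shows the weight of y to be positive,
    which permits the division before the infimum over u.\<close>
  have **: "Z * \<rho> (dist u x) \<le> weight \<rho> \<Lambda>' y" if "u \<in> \<Lambda>" for u
    unfolding weight_def by (rule cINF_greatest[OF ne(2)]) (rule *[OF that])
  have Zpos: "0 < Z * \<rho> (dist u x)" for u using Z pos by simp
  have "Z / weight \<rho> \<Lambda>' y \<le> weight \<rho> \<Lambda> x"
    unfolding weight_def[of \<rho> \<Lambda>]
  proof (rule cINF_greatest[OF ne(1)])
    fix u assume "u \<in> \<Lambda>"
    then show "Z / weight \<rho> \<Lambda>' y \<le> 1 / \<rho> (dist u x)"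
      using **[of u] Zpos[of u] pos[of u x] by (simp add: divide_simps)
  qed
  moreover have "0 < weight \<rho> \<Lambda>' y"
    using ne(1) ** Zpos by (meson ex_in_conv less_le_trans)
  ultimately have "Z \<le> weight \<rho> \<Lambda> x * weight \<rho> \<Lambda>' y"
    by (simp add: pos_divide_le_eq)
  then show ?thesis using Cr_pos rho_pos[OF D] by (simp add: Z_def pos_divide_le_eq mult.commute)
qed

text \<open>The first factor comes from \<open>separated_weights\<close>, the square from the
  weighted sums of the two oscillation majorants, the last factor from summing the rates of the sets
  at a site.\<close>

definition K\<^sub>0 :: "real \<Rightarrow> real" where
  "K\<^sub>0 L = Cr\<^sup>2 / \<rho> L * (2 / \<rho> 0)\<^sup>2 * enn2real (C_one c)"

lemma K0_nonneg: "0 \<le> L \<Longrightarrow> 0 \<le> K\<^sub>0 L"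
  using rho_pos[of L] by (simp add: K\<^sub>0_def)

text \<open>Two sites of a set with non-zero rate are less than L apart, so the factor
  \<open>Z * (w x * w' y)\<close>, at least 1, may be inserted. Then the sum over y is extended to
  all sites and the rest is a single sum controlled by (L1).\<close>

lemma interaction_le:
  fixes w w' B B' :: "'s \<Rightarrow> real"
  assumes range: "range_less c L" and A: "finite A" "A \<subseteq> {\<Delta>. finite \<Delta>}"
    and a: "\<And>x. 0 \<le> a x" "\<And>x. a x \<le> \<kappa> * B x" and b: "\<And>x. 0 \<le> b x" "\<And>x. b x \<le> \<kappa> * B' x"
    and close: "\<And>x y. dist x y \<le> L \<Longrightarrow> 1 \<le> Z * (w x * w' y)"
    and wB: "\<And>x. 0 \<le> w x * B x" "(\<lambda>x. w x * B x) summable_on UNIV" "infsum (\<lambda>x. w x * B x) UNIV \<le> U"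
    and wB': "\<And>x. 0 \<le> w' x * B' x" "(\<lambda>x. w' x * B' x) summable_on UNIV" "infsum (\<lambda>x. w' x * B' x) UNIV \<le> U'"
    and Z: "0 \<le> Z" and \<kappa>: "0 \<le> \<kappa>"
  shows "(\<Sum>\<Delta>\<in>A. rate_bound c \<Delta> * ((\<Sum>x\<in>\<Delta>. a x) * (\<Sum>y\<in>\<Delta>. b y)))
    \<le> Z * \<kappa>\<^sup>2 * (enn2real (C_one c) * U * U')"
proof -
  have U': "0 \<le> U'" using infsum_nonneg[of UNIV "\<lambda>x. w' x * B' x"] wB' by auto
  have "rate_bound c \<Delta> * ((\<Sum>x\<in>\<Delta>. a x) * (\<Sum>y\<in>\<Delta>. b y))
      \<le> Z * \<kappa>\<^sup>2 * U' * (rate_bound c \<Delta> * (\<Sum>x\<in>\<Delta>. w x * B x))" if \<Delta>: "\<Delta> \<in> A" for \<Delta>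
  proof (cases "diameter \<Delta> < L")
    case True
    have fin: "finite \<Delta>" using A \<Delta> by auto
    have "(\<Sum>x\<in>\<Delta>. a x) * (\<Sum>y\<in>\<Delta>. b y) = (\<Sum>x\<in>\<Delta>. \<Sum>y\<in>\<Delta>. a x * b y)"
      by (simp add: sum_product)
    also have "\<dots> \<le> (\<Sum>x\<in>\<Delta>. \<Sum>y\<in>\<Delta>. Z * \<kappa>\<^sup>2 * ((w x * B x) * (w' y * B' y)))"
    proof (intro sum_mono)
      fix x y assume "x \<in> \<Delta>" "y \<in> \<Delta>"
      then have "dist x y \<le> L"
        using diameter_bounded_bound[OF finite_imp_bounded[OF fin], of x y] True by simp
      note cl = close[OF this]
      have "a x * b y \<le> (\<kappa> * B x) * (\<kappa> * B' y)"
        using a b by (intro mult_mono) (auto intro: order_trans)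
      also have "\<dots> \<le> (\<kappa> * B x) * (\<kappa> * B' y) * (Z * (w x * w' y))"
        using mult_left_mono[OF cl, of "(\<kappa> * B x) * (\<kappa> * B' y)"] order_trans[OF a] order_trans[OF b] by simp
      finally show "a x * b y \<le> Z * \<kappa>\<^sup>2 * ((w x * B x) * (w' y * B' y))"
        by (simp add: power2_eq_square mult_ac)
    qed
    also have "\<dots> = Z * \<kappa>\<^sup>2 * ((\<Sum>x\<in>\<Delta>. w x * B x) * (\<Sum>y\<in>\<Delta>. w' y * B' y))"
      by (subst sum_product) (simp add: sum_distrib_left)
    also have "\<dots> \<le> Z * \<kappa>\<^sup>2 * ((\<Sum>x\<in>\<Delta>. w x * B x) * U')"
    proof -
      have "(\<Sum>y\<in>\<Delta>. w' y * B' y) \<le> U'"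
        using order_trans[OF finite_sum_le_infsum[OF wB'(2) fin] wB'(3)] wB'(1) by simp
      then show ?thesis using Z wB by (intro mult_left_mono) (auto simp: sum_nonneg)
    qed
    finally have "(\<Sum>x\<in>\<Delta>. a x) * (\<Sum>y\<in>\<Delta>. b y) \<le> Z * \<kappa>\<^sup>2 * ((\<Sum>x\<in>\<Delta>. w x * B x) * U')" .
    from mult_left_mono[OF this rate_bound_nonneg[of c \<Delta>]] show ?thesis
      by (simp add: mult_ac)
  next
    case False
    then have "rate_bound c \<Delta> = 0"
      using range A \<Delta> by (auto simp: range_less_def rate_bound_def)
    then show ?thesis by simp
  qed
  then have "(\<Sum>\<Delta>\<in>A. rate_bound c \<Delta> * ((\<Sum>x\<in>\<Delta>. a x) * (\<Sum>y\<in>\<Delta>. b y)))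
      \<le> Z * \<kappa>\<^sup>2 * U' * (\<Sum>\<Delta>\<in>A. rate_bound c \<Delta> * (\<Sum>x\<in>\<Delta>. w x * B x))"
    unfolding sum_distrib_left[of "Z * \<kappa>\<^sup>2 * U'"] by (rule sum_mono)
  also have "\<dots> \<le> Z * \<kappa>\<^sup>2 * U' * (enn2real (C_one c) * U)"
  proof (intro mult_left_mono)
    show "(\<Sum>\<Delta>\<in>A. rate_bound c \<Delta> * (\<Sum>x\<in>\<Delta>. w x * B x)) \<le> enn2real (C_one c) * U"
      using A order_trans[OF sum_rate_bound_sites_le[OF L1 A(1) _ wB(1,2)] mult_left_mono[OF wB(3)]] by auto
  qed (use Z U' in auto)
  finally show ?thesis by (simp add: mult_ac)
qed

text \<open>The Euler iterates satisfy the bound up to errors that vanish for suitable A and k; the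
  limit uses that the main term \<open>R\<close> depends on neither.\<close>

lemma covariance_bound:
  assumes anti: "antimono_on {0..} \<rho>" and L: "0 < L" and range: "range_less c L" and gb: "generated_by S c"
    and f: "f \<in> D_space" and g: "g \<in> D_space" and ne: "dep_set f \<noteq> {}" "dep_set g \<noteq> {}"
    and D: "0 \<le> D" and sep: "\<And>u v. u \<in> dep_set f \<Longrightarrow> v \<in> dep_set g \<Longrightarrow> D \<le> dist u v" and t: "0 < t"
  shows "\<bar>S t (bc_mult f g) \<eta> - S t f \<eta> * S t g \<eta>\<bar>
    \<le> t * (K\<^sub>0 L * (exp (t / \<theta>))\<^sup>2 * \<rho> D * tnorm f * tnorm g)"
proof -
  obtain B where B: "\<And>x. 0 \<le> B x" "B summable_on UNIV"
    "\<And>A h j x. admissible_step c A h \<Longrightarrow> osc x ((euler c A h ^^ j) f) \<le> (1 + h / \<theta>) ^ j * B x"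
    "(\<lambda>x. weight \<rho> (dep_set f) x * B x) summable_on UNIV"
    "(\<Sum>\<^sub>\<infinity>x. weight \<rho> (dep_set f) x * B x) \<le> 2 / \<rho> 0 * tnorm f"
    by (fact oscillation_majorant[OF anti f])
  obtain B' where B': "\<And>x. 0 \<le> B' x" "B' summable_on UNIV"
    "\<And>A h j x. admissible_step c A h \<Longrightarrow> osc x ((euler c A h ^^ j) g) \<le> (1 + h / \<theta>) ^ j * B' x"
    "(\<lambda>x. weight \<rho> (dep_set g) x * B' x) summable_on UNIV"
    "(\<Sum>\<^sub>\<infinity>x. weight \<rho> (dep_set g) x * B' x) \<le> 2 / \<rho> 0 * tnorm g"
    by (fact oscillation_majorant[OF anti g])
  define Z where "Z = Cr\<^sup>2 * \<rho> D / \<rho> L"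
  define \<kappa> where "\<kappa> = exp (t / \<theta>)"
  have Z: "0 \<le> Z" using rho_pos[OF D] rho_pos[of L] L by (simp add: Z_def)
  have S: "markov_semigroup S" using gb by (simp add: generated_by_def)
  define R where "R = Z * \<kappa>\<^sup>2 * (enn2real (C_one c) * (2 / \<rho> 0 * tnorm f) * (2 / \<rho> 0 * tnorm g))"
  have R_eq: "R = K\<^sub>0 L * (exp (t / \<theta>))\<^sup>2 * \<rho> D * tnorm f * tnorm g"
    by (simp add: R_def Z_def \<kappa>_def K\<^sub>0_def power2_eq_square)
  have close: "1 \<le> Z * (weight \<rho> (dep_set f) x * weight \<rho> (dep_set g) y)" if "dist x y \<le> L" for x y
    using separated_weights[OF anti ne D sep that] rho_pos[of L] L by (simp add: Z_def divide_simps mult_ac)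
  have interaction: "(\<Sum>\<Delta>\<in>A. rate_bound c \<Delta> * ((\<Sum>x\<in>\<Delta>. osc x ((euler c A (t / real k) ^^ j) f))
      * (\<Sum>y\<in>\<Delta>. osc y ((euler c A (t / real k) ^^ j) g)))) \<le> R"
    if A: "admissible_step c A (t / real k)" and j: "j < k" for A j k
    unfolding R_def
  proof (rule interaction_le[OF range _ _ osc_nonneg _ osc_nonneg _ close
      mult_nonneg_nonneg[OF weight_nonneg[OF ne(1)] B(1)] B(4,5)
      mult_nonneg_nonneg[OF weight_nonneg[OF ne(2)] B'(1)] B'(4,5) Z])
    have p: "(1 + t / real k / \<theta>) ^ j \<le> \<kappa>"
      unfolding \<kappa>_def using t j by (intro power_step_le) auto
    show "osc x ((euler c A (t / real k) ^^ j) f) \<le> \<kappa> * B x" for x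
      by (rule order_trans[OF B(3)[OF A] mult_right_mono[OF p B(1)]])
    show "osc x ((euler c A (t / real k) ^^ j) g) \<le> \<kappa> * B' x" for x
      by (rule order_trans[OF B'(3)[OF A] mult_right_mono[OF p B'(1)]])
  qed (use A in \<open>auto simp: admissible_step_def \<kappa>_def\<close>)
  have "\<bar>S t (bc_mult f g) \<eta> - S t f \<eta> * S t g \<eta>\<bar> \<le> t * R + e" if e: "0 < e" for e
  proof -
    \<comment> \<open>Two errors of size d come from the product defect and from fg, and
      \<open>norm f * d + d * norm g\<close> from the product of the limits; together they make
      e.\<close>
    define d where "d = e / (2 + norm f + norm g)"
    have q: "0 < 2 + norm f + norm g" using norm_ge_zero[of f] norm_ge_zero[of g] by linarith
    then have d: "0 < d" and d_e: "d * (2 + norm f + norm g) = e" using e by (simp_all add: d_def)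
    note lim = euler_tendsto_semigroup[OF anti gb _ t d]
    \<comment> \<open>One truncation, and below one number of steps, must serve f, g and fg at the
      same time.\<close>
    have "eventually (\<lambda>A. finite A \<and> A \<subseteq> {\<Delta>. finite \<Delta>}) (finite_subsets_at_top {\<Delta> :: 's set. finite \<Delta>})"
      by (rule eventually_finite_subsets_at_top_weakI) auto
    from eventually_happens'[OF finite_subsets_at_top_neq_bot eventually_conj[OF this
      eventually_conj[OF lim[OF f] eventually_conj[OF lim[OF g] lim[OF D_space_bc_mult[OF f g]]]]]]
    obtain A where A: "finite A" "A \<subseteq> {\<Delta>. finite \<Delta>}"
      and ev: "eventually (\<lambda>k. norm ((euler c A (t / real k) ^^ k) f - S t f) < d) sequentially"
        "eventually (\<lambda>k. norm ((euler c A (t / real k) ^^ k) g - S t g) < d) sequentially"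
        "eventually (\<lambda>k. norm ((euler c A (t / real k) ^^ k) (bc_mult f g) - S t (bc_mult f g)) < d) sequentially"
      by blast
    define C where "C = t * (t * ((2 * (\<Sum>\<Delta>\<in>A. rate_bound c \<Delta>))\<^sup>2 * norm f * norm g))"
    have "eventually (\<lambda>k. C / real k < d) sequentially"
      by (rule order_tendstoD(2)[OF lim_const_over_n d])
    from eventually_happens'[OF sequentially_bot eventually_conj[OF this eventually_conj[OF ev(1)
      eventually_conj[OF ev(2) eventually_conj[OF ev(3)
      eventually_conj[OF eventually_admissible[OF A less_imp_le[OF t]] eventually_gt_at_top[of 0]]]]]]]
    obtain k where k: "C / real k < d" "norm ((euler c A (t / real k) ^^ k) f - S t f) < d"
        "norm ((euler c A (t / real k) ^^ k) g - S t g) < d"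
        "norm ((euler c A (t / real k) ^^ k) (bc_mult f g) - S t (bc_mult f g)) < d"
        "admissible_step c A (t / real k)" "0 < k"
      by blast
    define h where "h = t / real k"
    note adm = k(5)[folded h_def]
    define F G FG where "F = (euler c A h ^^ k) f" and "G = (euler c A h ^^ k) g"
      and "FG = (euler c A h ^^ k) (bc_mult f g)"
    have h: "0 \<le> h" and kh: "real k * h = t" using t k by (simp_all add: h_def)
    let ?E = "h\<^sup>2 * (2 * (\<Sum>\<Delta>\<in>A. rate_bound c \<Delta>))\<^sup>2 * norm f * norm g"
    have "norm (FG - bc_mult F G) \<le> real k * (h * R + ?E)"
      unfolding F_def G_def FG_def
    proof (rule euler_iterate_product_defect[OF rates_nonneg adm])
      fix j assume j: "j < k"
      let ?a = "(euler c A h ^^ j) f" and ?b = "(euler c A h ^^ j) g"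
      have "norm ?a * norm ?b \<le> norm f * norm g"
        by (intro mult_mono norm_euler_iterate_le[OF rates_nonneg adm]) auto
      then have "h\<^sup>2 * (2 * (\<Sum>\<Delta>\<in>A. rate_bound c \<Delta>))\<^sup>2 * norm ?a * norm ?b \<le> ?E"
        unfolding mult.assoc by (intro mult_left_mono) auto
      moreover have "h * (\<Sum>\<Delta>\<in>A. rate_bound c \<Delta> * ((\<Sum>x\<in>\<Delta>. osc x ?a) * (\<Sum>y\<in>\<Delta>. osc y ?b))) \<le> h * R"
        using interaction[OF k(5) j] h by (intro mult_left_mono) (simp_all add: h_def)
      ultimately show "norm (euler c A h (bc_mult ?a ?b)
          - bc_mult ((euler c A h ^^ Suc j) f) ((euler c A h ^^ Suc j) g)) \<le> h * R + ?E"
        using order_trans[OF euler_product_defect[OF rates_nonneg adm, of ?a ?b] add_mono] by simp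
    qed
    \<comment> \<open>Because k h = t, the k second-order terms of size h^2 add up to order 1 /
      k.\<close>
    also have "\<dots> = t * R + C / real k"
      using k(6) unfolding kh[symmetric] C_def by (simp add: power2_eq_square field_simps)
    finally have 1: "norm (FG - bc_mult F G) \<le> t * R + d" using k(1) by simp
    have 2: "\<bar>FG \<eta> - F \<eta> * G \<eta>\<bar> \<le> t * R + d"
      using order_trans[OF norm_bounded 1, of \<eta>] by simp
    have 3: "\<bar>FG \<eta> - S t (bc_mult f g) \<eta>\<bar> \<le> d" "\<bar>F \<eta> - S t f \<eta>\<bar> \<le> d" "\<bar>G \<eta> - S t g \<eta>\<bar> \<le> d"
      using norm_bounded[of "FG - S t (bc_mult f g)" \<eta>] norm_bounded[of "F - S t f" \<eta>]
        norm_bounded[of "G - S t g" \<eta>] k(2-4) unfolding FG_def F_def G_def h_def by auto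
    have "\<bar>F \<eta> * G \<eta> - S t f \<eta> * S t g \<eta>\<bar> = \<bar>F \<eta> * (G \<eta> - S t g \<eta>) + (F \<eta> - S t f \<eta>) * S t g \<eta>\<bar>"
      by (simp add: algebra_simps)
    also have "\<dots> \<le> \<bar>F \<eta>\<bar> * \<bar>G \<eta> - S t g \<eta>\<bar> + \<bar>F \<eta> - S t f \<eta>\<bar> * \<bar>S t g \<eta>\<bar>"
      by (metis abs_mult abs_triangle_ineq)
    also have "\<dots> \<le> norm f * d + d * norm g"
    proof (intro add_mono mult_mono 3)
      show "\<bar>F \<eta>\<bar> \<le> norm f"
        using order_trans[OF norm_bounded norm_euler_iterate_le[OF rates_nonneg adm]] by (simp add: F_def)
      show "\<bar>S t g \<eta>\<bar> \<le> norm g"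
        using order_trans[OF norm_bounded markov_contraction[OF S less_imp_le[OF t]]] by simp
    qed (use d in auto)
    finally have "\<bar>S t (bc_mult f g) \<eta> - S t f \<eta> * S t g \<eta>\<bar> \<le> d + (t * R + d) + (norm f * d + d * norm g)"
      using 2 3(1) by linarith
    also have "\<dots> = t * R + e" unfolding d_e[symmetric] by (simp add: algebra_simps)
    finally show ?thesis .
  qed
  then have "\<bar>S t (bc_mult f g) \<eta> - S t f \<eta> * S t g \<eta>\<bar> \<le> t * R" by (rule field_le_epsilon)
  then show ?thesis unfolding R_eq .
qed

end

subsection \<open>Interpolation between growth and decay\<close>

text \<open>Short times are controlled by the exponentially growing bound, long times by the decay; the two
  balance at \<open>T = - ln R / (2 * B)\<close>.\<close>

lemma growth_decay_interpolation:
  fixes H :: "real \<Rightarrow> real"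
  assumes R: "0 < R" and B: "0 < B" and a: "0 < a" and P: "0 \<le> P" and K: "0 \<le> K0" "0 \<le> K1"
    and triv: "\<And>t. 0 \<le> t \<Longrightarrow> \<bar>H t\<bar> \<le> 2 * P"
    and growth: "\<And>t. 0 \<le> t \<Longrightarrow> \<bar>H t\<bar> \<le> K0 * exp (B * t) * R * P"
    and decay: "\<And>s t. 0 \<le> s \<Longrightarrow> s \<le> t \<Longrightarrow> \<bar>H t - H s\<bar> \<le> K1 * exp (- a * s) * P"
    and t: "0 \<le> t"
  shows "\<bar>H t\<bar> \<le> (2 + K0 + K1) * R powr min (1 / 2) (a / (2 * B)) * P"
proof (cases "R < 1")
  case False
  define \<alpha> where "\<alpha> = min (1 / 2) (a / (2 * B))"
  \<comment> \<open>Here the factor \<open>R powr \<alpha>\<close> is no gain, and the trivial bound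
    suffices.\<close>
  have "1 \<le> R powr \<alpha>" using False a B by (intro ge_one_powr_ge_zero) (auto simp: \<alpha>_def)
  then have "2 * P \<le> (2 + K0 + K1) * R powr \<alpha> * P"
    using P K mult_mono[of 2 "2 + K0 + K1" 1 "R powr \<alpha>"] by (intro mult_right_mono) auto
  with triv[OF t] show ?thesis by (simp add: \<alpha>_def)
next
  case True
  define \<alpha> where "\<alpha> = min (1 / 2) (a / (2 * B))"
  define T where "T = - ln R / (2 * B)"
  have T: "0 \<le> T" using True R B by (simp add: T_def divide_nonpos_pos)
  \<comment> \<open>At time T the growth bound leaves R to the power 1/2, and the decay factor is R
    to the power a / (2 B). As R < 1, the smaller exponent serves both.\<close>
  have "exp (B * T) * R = exp (- ln R / 2) * exp (ln R)"
    using B R by (simp add: T_def)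
  also have "\<dots> = exp (ln R / 2)"
    unfolding exp_add[symmetric] by simp
  also have "\<dots> = R powr (1 / 2)"
    using R by (simp add: powr_def)
  also have "\<dots> \<le> R powr \<alpha>"
    using True R by (intro powr_mono') (auto simp: \<alpha>_def)
  finally have R1: "exp (B * T) * R \<le> R powr \<alpha>" .
  have "exp (- a * T) = R powr (a / (2 * B))"
    using R by (simp add: T_def powr_def)
  also have "\<dots> \<le> R powr \<alpha>"
    using True R by (intro powr_mono') (auto simp: \<alpha>_def)
  finally have R2: "exp (- a * T) \<le> R powr \<alpha>" .
  have short: "\<bar>H s\<bar> \<le> K0 * R powr \<alpha> * P" if "0 \<le> s" "s \<le> T" for s
  proof -
    have "exp (B * s) * R \<le> exp (B * T) * R" using that B R by simp
    also note R1
    finally have "K0 * (exp (B * s) * R) * P \<le> K0 * R powr \<alpha> * P"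
      using K P by (intro mult_right_mono mult_left_mono)
    with growth[OF that(1)] show ?thesis by (simp add: mult.assoc)
  qed
  have "\<bar>H t\<bar> \<le> K0 * R powr \<alpha> * P + K1 * R powr \<alpha> * P"
  proof (cases "t \<le> T")
    case True
    moreover have "0 \<le> K1 * R powr \<alpha> * P" using K P by simp
    ultimately show ?thesis using short[OF t] by linarith
  next
    \<comment> \<open>Beyond T the value of H is compared with the one at T, where the growth bound
      still holds.\<close>
    case False
    have "K1 * exp (- a * T) * P \<le> K1 * R powr \<alpha> * P"
      using K P R2 by (intro mult_right_mono mult_left_mono)
    then show ?thesis using short[OF T order_refl] decay[OF T, of t] False by linarith
  qed
  also have "\<dots> \<le> (2 + K0 + K1) * R powr \<alpha> * P"
    using P by (simp add: algebra_simps)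
  finally show ?thesis by (simp add: \<alpha>_def)
qed

text \<open>The covariance is bilinear and vanishes when one argument is constant, as the semigroup
  fixes constants.\<close>

lemma markov_covariance_diff_const:
  assumes S: "markov_semigroup S" and t: "0 \<le> t"
  shows "S t (bc_mult (f - const_bcontfun a) (g - const_bcontfun b)) x
      - S t (f - const_bcontfun a) x * S t (g - const_bcontfun b) x
    = S t (bc_mult f g) x - S t f x * S t g x"
proof -
  have expand: "bc_mult (f - const_bcontfun a) (g - const_bcontfun b)
      = bc_mult f g - a *\<^sub>R g - b *\<^sub>R f + const_bcontfun (a * b)"
    by (rule bcontfun_eqI) (simp add: const_bcontfun.rep_eq algebra_simps)
  show ?thesis
    unfolding expand using markov_linear[OF S t]
    by (simp add: linear_diff linear_add linear_scale markov_const[OF S t] const_bcontfun.rep_eq algebra_simps)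
qed

lemma set_dist_le_dist:
  assumes "u \<in> A" "v \<in> B"
  shows "enn2real (set_dist A B) \<le> dist u v"
proof (rule enn2real_leI)
  show "set_dist A B \<le> ennreal (dist u v)"
    unfolding set_dist_def by (rule INF_lower2[OF assms(1)], rule INF_lower[OF assms(2)])
qed simp

section \<open>Decay of correlations uniformly in time, and its limit for large times\<close>

theorem theorem2p4:
  fixes c :: "('s::{metric_space, countable}, 'q::{finite, discrete_topology}) rates"
    and \<rho> :: "real \<Rightarrow> real"
    and L Khat \<alpha>hat :: real
    and S :: "real \<Rightarrow> ('s, 'q) obs \<Rightarrow> ('s, 'q) obs"
    and \<eta> :: "'s \<Rightarrow> 'q"
    and \<mu> :: "('s \<Rightarrow> 'q) measure"
  assumes "infinite (UNIV :: 's set)"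
    and "rates_nonneg c"
    and "L > 0"
    and "\<And>r. r \<ge> 0 \<Longrightarrow> \<rho> r > 0"
    and "antimono_on {0..} \<rho>"
    and L1: "C_one c < \<infinity>"
    and R1: "range_less c L"
    and R2: "C_rho TYPE('s) \<rho> < \<infinity>"
    and R3: "C_gamma c \<rho> < \<infinity>"
    and S: "generated_by S c"
    and "prob_space \<mu>" and "sets \<mu> = sets borel"
    and "Khat > 0" and "\<alpha>hat > 0"
    and decay: "\<And>f t. f \<in> D_space \<Longrightarrow> t \<ge> 0 \<Longrightarrow>
      \<bar>S t f \<eta> - (\<integral>\<omega>. f \<omega> \<partial>\<mu>)\<bar> \<le> Khat * exp (- \<alpha>hat * t) * tnorm f"
  shows "\<exists>K>0. \<exists>\<alpha>>0.
    (\<forall>t\<ge>0. \<forall>f\<in>D_space. \<forall>g\<in>D_space.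
       set_dist (dep_set f) (dep_set g) > ennreal L * C_rho TYPE('s) \<rho> \<longrightarrow>
       \<bar>S t (bc_mult f g) \<eta> - S t f \<eta> * S t g \<eta>\<bar>
         \<le> K * tnorm f * tnorm g * \<rho> (enn2real (set_dist (dep_set f) (dep_set g))) powr \<alpha>) \<and>
    (\<forall>f\<in>D_space. \<forall>g\<in>D_space.
       set_dist (dep_set f) (dep_set g) > ennreal L * C_rho TYPE('s) \<rho> \<longrightarrow>
       \<bar>(\<integral>\<omega>. f \<omega> * g \<omega> \<partial>\<mu>) - (\<integral>\<omega>. f \<omega> \<partial>\<mu>) * (\<integral>\<omega>. g \<omega> \<partial>\<mu>)\<bar>
         \<le> K * tnorm f * tnorm g * \<rho> (enn2real (set_dist (dep_set f) (dep_set g))) powr \<alpha>)"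
proof -
  interpret weighted_rates c \<rho>
    using assms by unfold_locales auto
  have markov: "markov_semigroup S" using S by (simp add: generated_by_def)
  \<comment> \<open>2 / \<theta> is the growth rate of the squared exponential in
    \<open>covariance_bound\<close>; the extra 1 absorbs its linear factor t.\<close>
  define B where "B = 2 / \<theta> + 1"
  have B: "0 < B" using theta_pos by (simp add: B_def add_pos_pos)
  define \<alpha> where "\<alpha> = min (1 / 2) (\<alpha>hat / (2 * B))"
  \<comment> \<open>The three summands are the constants of the trivial, growth and decay bounds
    that enter the interpolation.\<close>
  define K where "K = 2 + K\<^sub>0 L + 8 * Khat"
  have K: "0 < K" and \<alpha>: "0 < \<alpha>"
    using K0_nonneg[of L] assms(3) \<open>Khat > 0\<close> \<open>\<alpha>hat > 0\<close> B by (simp_all add: K_def \<alpha>_def)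
  have bound: "\<bar>S t (bc_mult f g) \<eta> - S t f \<eta> * S t g \<eta>\<bar>
      \<le> K * tnorm f * tnorm g * \<rho> (enn2real (set_dist (dep_set f) (dep_set g))) powr \<alpha>"
    if f: "f \<in> D_space" and g: "g \<in> D_space" and t: "0 \<le> t" for f g t
  proof -
    define D where "D = enn2real (set_dist (dep_set f) (dep_set g))"
    have D: "0 \<le> D" by (simp add: D_def)
    \<comment> \<open>Centring at \<eta> leaves the covariance, the oscillations and the dependence
      sets unchanged, but bounds the supremum norms by \<open>tnorm\<close>.\<close>
    define f0 g0 where "f0 = f - const_bcontfun (f \<eta>)" and "g0 = g - const_bcontfun (g \<eta>)"
    have f0: "f0 \<in> D_space" "tnorm f0 = tnorm f" "dep_set f0 = dep_set f"
      and g0: "g0 \<in> D_space" "tnorm g0 = tnorm g" "dep_set g0 = dep_set g"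
      using f g by (simp_all add: f0_def g0_def)
    have nf: "norm f0 \<le> tnorm f" and ng: "norm g0 \<le> tnorm g"
      using diff_le_tnorm[OF f] diff_le_tnorm[OF g]
      by (auto simp: f0_def g0_def const_bcontfun.rep_eq intro!: norm_bound)
    define H where "H s = S s (bc_mult f0 g0) \<eta> - S s f0 \<eta> * S s g0 \<eta>" for s
    define P where "P = tnorm f * tnorm g"
    have P: "0 \<le> P" by (simp add: P_def)
    have Sf: "\<bar>S s f0 \<eta>\<bar> \<le> tnorm f" and Sg: "\<bar>S s g0 \<eta>\<bar> \<le> tnorm g" if "0 \<le> s" for s
      using order_trans[OF norm_bounded[of "S s f0" \<eta>] order_trans[OF markov_contraction[OF markov that] nf]]
        order_trans[OF norm_bounded[of "S s g0" \<eta>] order_trans[OF markov_contraction[OF markov that] ng]]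
      by simp_all
    have triv: "\<bar>H s\<bar> \<le> 2 * P" if s: "0 \<le> s" for s
    proof -
      have "\<bar>S s (bc_mult f0 g0) \<eta>\<bar> \<le> norm (bc_mult f0 g0)"
        using order_trans[OF norm_bounded[of _ \<eta>] markov_contraction[OF markov s]] by simp
      also have "\<dots> \<le> P"
        unfolding P_def using mult_mono[OF nf ng] by (intro order_trans[OF norm_bc_mult]) auto
      finally have "\<bar>S s (bc_mult f0 g0) \<eta>\<bar> \<le> P" .
      moreover have "\<bar>S s f0 \<eta> * S s g0 \<eta>\<bar> \<le> P"
        unfolding abs_mult P_def using Sf[OF s] Sg[OF s] by (intro mult_mono) auto
      ultimately show ?thesis unfolding H_def by linarith
    qed
    have growth: "\<bar>H s\<bar> \<le> K\<^sub>0 L * exp (B * s) * \<rho> D * P" if s: "0 \<le> s" for s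
    proof (cases "dep_set f = {} \<or> dep_set g = {}")
      \<comment> \<open>The distance is infinite here, which \<open>enn2real\<close> sends to 0;
        this is harmless because P = 0.\<close>
      case True
      then have "P = 0" by (auto simp: P_def tnorm_def dep_set_def)
      then show ?thesis using triv[OF s] by simp
    next
      case False
      show ?thesis
      \<comment> \<open>\<open>covariance_bound\<close> is stated for positive times; at time 0 the
        covariance is 0.\<close>
      proof (cases "s = 0")
        case True
        have "H s = 0" using markov by (simp add: H_def True markov_semigroup_def)
        then show ?thesis using K0_nonneg[of L] assms(3) P rho_pos[OF D] by simp
      next
        case s0: False
        have "\<bar>H s\<bar> \<le> s * (K\<^sub>0 L * (exp (s / \<theta>))\<^sup>2 * \<rho> D * tnorm f0 * tnorm g0)"
          unfolding H_def
          by (rule covariance_bound[OF assms(5) assms(3) R1 S f0(1) g0(1)])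
            (use False s s0 D in \<open>auto simp: f0 g0 D_def set_dist_le_dist\<close>)
        also have "\<dots> = s * (exp (s / \<theta>))\<^sup>2 * (K\<^sub>0 L * \<rho> D * P)"
          by (simp add: f0 g0 P_def mult_ac)
        also have "\<dots> \<le> exp (B * s) * (K\<^sub>0 L * \<rho> D * P)"
        proof (rule mult_right_mono)
          have "s \<le> exp s" using exp_ge_add_one_self[of s] by linarith
          then have "s * (exp (s / \<theta>))\<^sup>2 \<le> exp s * (exp (s / \<theta>))\<^sup>2" by (rule mult_right_mono) simp
          also have "\<dots> = exp (B * s)"
            by (simp add: B_def power2_eq_square algebra_simps flip: exp_add)
          finally show "s * (exp (s / \<theta>))\<^sup>2 \<le> exp (B * s)" .
          show "0 \<le> K\<^sub>0 L * \<rho> D * P" using K0_nonneg[of L] assms(3) P rho_pos[OF D] by simp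
        qed
        finally show ?thesis by (simp add: mult_ac)
      qed
    qed
    have decay_H: "\<bar>H s' - H s\<bar> \<le> 8 * Khat * exp (- \<alpha>hat * s) * P" if s: "0 \<le> s" "s \<le> s'" for s s'
    proof -
      \<comment> \<open>Both times are compared with \<mu>, whence the factor 2. The terms for f0 g0
        and for the product contribute 2 E P each, so 8 \<open>Khat\<close> in total.\<close>
      define E where "E = 2 * (Khat * exp (- \<alpha>hat * s))"
      have E: "0 \<le> E" using \<open>Khat > 0\<close> by (simp add: E_def)
      have dec: "\<bar>S s' h \<eta> - S s h \<eta>\<bar> \<le> E * tnorm h" if h: "h \<in> D_space" for h
      proof -
        have "Khat * exp (- \<alpha>hat * s') * tnorm h \<le> Khat * exp (- \<alpha>hat * s) * tnorm h"
          using s \<open>Khat > 0\<close> \<open>\<alpha>hat > 0\<close> by (intro mult_right_mono mult_left_mono) auto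
        then show ?thesis using decay[OF h, of s] decay[OF h, of s'] s unfolding E_def by linarith
      qed
      have "tnorm (bc_mult f0 g0) \<le> 2 * P"
        using tnorm_bc_mult[OF f0(1) g0(1)] mult_right_mono[OF nf tnorm_nonneg[of g]]
          mult_right_mono[OF ng tnorm_nonneg[of f]] by (simp add: P_def f0 g0 mult.commute)
      then have "\<bar>S s' (bc_mult f0 g0) \<eta> - S s (bc_mult f0 g0) \<eta>\<bar> \<le> E * (2 * P)"
        using dec[OF D_space_bc_mult[OF f0(1) g0(1)]] E by (meson mult_left_mono order_trans)
      moreover have "\<bar>S s' f0 \<eta> * S s' g0 \<eta> - S s f0 \<eta> * S s g0 \<eta>\<bar> \<le> 2 * E * P"
      proof -
        have "S s' f0 \<eta> * S s' g0 \<eta> - S s f0 \<eta> * S s g0 \<eta>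
            = (S s' f0 \<eta> - S s f0 \<eta>) * S s' g0 \<eta> + S s f0 \<eta> * (S s' g0 \<eta> - S s g0 \<eta>)"
          by (simp add: algebra_simps)
        also have "\<bar>\<dots>\<bar> \<le> \<bar>S s' f0 \<eta> - S s f0 \<eta>\<bar> * \<bar>S s' g0 \<eta>\<bar> + \<bar>S s f0 \<eta>\<bar> * \<bar>S s' g0 \<eta> - S s g0 \<eta>\<bar>"
          by (metis abs_mult abs_triangle_ineq)
        also have "\<dots> \<le> (E * tnorm f) * tnorm g + tnorm f * (E * tnorm g)"
          using dec[OF f0(1)] dec[OF g0(1)] Sf[OF s(1)] Sg[of s'] s E
          by (intro add_mono mult_mono) (auto simp: f0 g0)
        finally show ?thesis by (simp add: P_def algebra_simps)
      qed
      ultimately have "\<bar>H s' - H s\<bar> \<le> E * (2 * P) + 2 * E * P" unfolding H_def by linarith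
      then show ?thesis by (simp add: E_def algebra_simps)
    qed
    have "H t = S t (bc_mult f g) \<eta> - S t f \<eta> * S t g \<eta>"
      unfolding H_def f0_def g0_def by (rule markov_covariance_diff_const[OF markov t])
    moreover have "\<bar>H t\<bar> \<le> K * \<rho> D powr \<alpha> * P"
      unfolding K_def \<alpha>_def
      by (rule growth_decay_interpolation[OF rho_pos[OF D] B \<open>\<alpha>hat > 0\<close> P _ _ triv growth decay_H t])
        (use K0_nonneg[of L] assms(3) \<open>Khat > 0\<close> in auto)
    ultimately show ?thesis by (simp add: D_def P_def mult_ac)
  qed
  have stationary: "\<bar>(\<integral>\<omega>. f \<omega> * g \<omega> \<partial>\<mu>) - (\<integral>\<omega>. f \<omega> \<partial>\<mu>) * (\<integral>\<omega>. g \<omega> \<partial>\<mu>)\<bar>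
      \<le> K * tnorm f * tnorm g * \<rho> (enn2real (set_dist (dep_set f) (dep_set g))) powr \<alpha>"
    if f: "f \<in> D_space" and g: "g \<in> D_space" for f g
  proof -
    have lim: "((\<lambda>t. S t h \<eta>) \<longlongrightarrow> (\<integral>\<omega>. h \<omega> \<partial>\<mu>)) at_top" if h: "h \<in> D_space" for h
    proof -
      have "((\<lambda>t. Khat * exp (- \<alpha>hat * t) * tnorm h) \<longlongrightarrow> 0) at_top"
        using \<open>\<alpha>hat > 0\<close> by real_asymp
      then have "((\<lambda>t. S t h \<eta> - (\<integral>\<omega>. h \<omega> \<partial>\<mu>)) \<longlongrightarrow> 0) at_top"
        by (rule Lim_null_comparison[rotated])
          (use decay[OF h] in \<open>auto intro!: eventually_mono[OF eventually_ge_at_top[of 0]]\<close>)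
      then show ?thesis by (simp add: LIM_zero_iff)
    qed
    \<comment> \<open>The assumed decay applies to f, g and also fg, which has summable
      oscillations, and the bound on the covariance is uniform in t.\<close>
    have "((\<lambda>t. \<bar>S t (bc_mult f g) \<eta> - S t f \<eta> * S t g \<eta>\<bar>)
        \<longlongrightarrow> \<bar>(\<integral>\<omega>. bc_mult f g \<omega> \<partial>\<mu>) - (\<integral>\<omega>. f \<omega> \<partial>\<mu>) * (\<integral>\<omega>. g \<omega> \<partial>\<mu>)\<bar>) at_top"
      by (intro tendsto_intros lim f g D_space_bc_mult)
    then show ?thesis
      unfolding apply_bc_mult
      by (rule tendsto_upperbound)
        (use bound[OF f g] in \<open>auto intro!: eventually_mono[OF eventually_ge_at_top[of 0]]\<close>)
  qed
  show ?thesis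
    by (intro exI[of _ K] exI[of _ \<alpha>] conjI K \<alpha> allI ballI impI bound stationary)
qed

end
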